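(* Let $N>p>1$ with $N$ an integer, let $g:\mathbb{R}^N\to\mathbb{R}$ be continuous with $g(x)>0$ for all $x\in\mathbb{R}^N$, and let $\hat f:[0,+\infty)\to\mathbb{R}$ be continuous with $\hat f(0)=0$ and $\hat f(t)>0$ for $t>0$. Let $u\in D^{1,p}(\mathbb{R}^N)\cap C^{1,\alpha}_{loc}(\mathbb{R}^N)$ (for some $\alpha>0$) be a (weak) solution of $$-\Delta_p u=g(x)\hat f(u)\ \text{ in }\mathbb{R}^N,\qquad u\ge 0\ \text{ in }\mathbb{R}^N.$$ If $\liminf_{|x|\to\infty}|x|^{(N-p)/(p-1)}u(x)=0$, then $u\equiv 0$.
   Context: $\Delta_p u=\mathrm{div}(|\nabla u|^{p-2}\nabla u)$, with the equation understood in the weak sense. $D^{1,p}(\mathbb{R}^N)=\{u\in L^{p^*}(\mathbb{R}^N):\nabla u\in L^p(\mathbb{R}^N,\mathbb{R}^N)\}$, where $p^*=\frac{pN}{N-p}$. *)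

theory Defs
  imports "HOL-Analysis.Analysis"
begin

definition grad :: "('a::euclidean_space \<Rightarrow> real) \<Rightarrow> 'a \<Rightarrow> 'a" where
  "grad f x = (\<Sum>b\<in>Basis. frechet_derivative f (at x) b *\<^sub>R b)"

lemma gderiv_grad:
  assumes "f differentiable (at x)"
  shows "GDERIV f x :> grad f x"
proof -
  have D: "(f has_derivative frechet_derivative f (at x)) (at x)"
    using assms frechet_derivative_works by blast
  then interpret linear "frechet_derivative f (at x)"
    by (rule has_derivative_linear)
  have "frechet_derivative f (at x) h = h \<bullet> grad f x" for h
  proof -
    have "frechet_derivative f (at x) h
        = frechet_derivative f (at x) (\<Sum>b\<in>Basis. (h \<bullet> b) *\<^sub>R b)"
      by (simp only: euclidean_representation)
    also have "\<dots> = (\<Sum>b\<in>Basis. (h \<bullet> b) * frechet_derivative f (at x) b)"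
      by (simp add: sum scaleR)
    also have "\<dots> = h \<bullet> grad f x"
      by (simp add: grad_def inner_sum_right mult.commute)
    finally show ?thesis .
  qed
  then have "frechet_derivative f (at x) = (\<lambda>h. h \<bullet> grad f x)" by blast
  with D show ?thesis by (simp add: gderiv_def)
qed

primrec C_k :: "nat \<Rightarrow> ('a::euclidean_space \<Rightarrow> real) \<Rightarrow> bool" where
  "C_k 0 f \<longleftrightarrow> continuous_on UNIV f"
| "C_k (Suc k) f \<longleftrightarrow>
     (\<forall>x. f differentiable (at x)) \<and> (\<forall>b\<in>Basis. C_k k (\<lambda>x. grad f x \<bullet> b))"

definition test_function :: "('a::euclidean_space \<Rightarrow> real) \<Rightarrow> bool" where
  "test_function \<phi> \<longleftrightarrow> (\<forall>k. C_k k \<phi>) \<and> compact (closure {x. \<phi> x \<noteq> 0})"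

text \<open>The local space \<open>C\<^sup>1\<^sup>,\<^sup>\<alpha>\<close>, for \<open>\<alpha> > 0\<close>: continuity of the gradient follows from the
  Hoelder bound on compact balls.\<close>

definition C1_Hoelder_loc :: "real \<Rightarrow> ('a::euclidean_space \<Rightarrow> real) \<Rightarrow> bool" where
  "C1_Hoelder_loc \<alpha> u \<longleftrightarrow>
     (\<forall>x. u differentiable (at x)) \<and>
     (\<forall>K. compact K \<longrightarrow>
        (\<exists>C. \<forall>x\<in>K. \<forall>y\<in>K. norm (grad u x - grad u y) \<le> C * dist x y powr \<alpha>))"

definition in_Lp ::
    "real \<Rightarrow> ('a::euclidean_space \<Rightarrow> 'b::euclidean_space) \<Rightarrow> bool" where
  "in_Lp p f \<longleftrightarrow>
     f \<in> borel_measurable lebesgue \<and> integrable lebesgue (\<lambda>x. norm (f x) powr p)"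

definition locally_integrable ::
    "('a::euclidean_space \<Rightarrow> 'b::euclidean_space) \<Rightarrow> bool" where
  "locally_integrable f \<longleftrightarrow> (\<forall>K. compact K \<longrightarrow> set_integrable lebesgue K f)"

definition weak_gradient :: "('a::euclidean_space \<Rightarrow> real) \<Rightarrow> ('a \<Rightarrow> 'a) \<Rightarrow> bool" where
  "weak_gradient u G \<longleftrightarrow>
     locally_integrable u \<and> locally_integrable G \<and>
     (\<forall>\<phi>. test_function \<phi> \<longrightarrow> (\<forall>b\<in>Basis.
        (\<integral>x. u x * (grad \<phi> x \<bullet> b) \<partial>lebesgue) = - (\<integral>x. (G x \<bullet> b) * \<phi> x \<partial>lebesgue)))"

definition critical_exponent :: "nat \<Rightarrow> real \<Rightarrow> real" where
  "critical_exponent N p = p * real N / (real N - p)"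

definition D1p :: "real \<Rightarrow> ('a::euclidean_space \<Rightarrow> real) set" where
  "D1p p = {u. in_Lp (critical_exponent DIM('a) p) u \<and>
               (\<exists>G. weak_gradient u G \<and> in_Lp p G)}"

text \<open>Weak solutions of \<open>- \<Delta>\<^sub>p u = h\<close> on the whole space. The weak gradient is unique up to
  null sets, so the choice of \<open>G\<close> is immaterial. Since \<open>0 powr a = 0\<close> for all \<open>a\<close>, the field
  \<open>\<bar>G\<bar>\<^sup>p\<^sup>-\<^sup>2 G\<close> vanishes where \<open>G\<close> does, also for \<open>p < 2\<close>.\<close>

definition p_Laplace_weak_solution ::
    "real \<Rightarrow> ('a::euclidean_space \<Rightarrow> real) \<Rightarrow> ('a \<Rightarrow> real) \<Rightarrow> bool" where
  "p_Laplace_weak_solution p h u \<longleftrightarrow>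
     (\<exists>G. weak_gradient u G \<and>
        locally_integrable (\<lambda>x. norm (G x) powr (p - 2) *\<^sub>R G x) \<and>
        locally_integrable h \<and>
        (\<forall>\<phi>. test_function \<phi> \<longrightarrow>
           (\<integral>x. (norm (G x) powr (p - 2) *\<^sub>R G x) \<bullet> grad \<phi> x \<partial>lebesgue)
             = (\<integral>x. h x * \<phi> x \<partial>lebesgue)))"

end

theory Submission
  imports Defs
begin

text \<open>If \<open>u x0 > 0\<close>, then \<open>u\<close> is bounded below by a positive constant on a ball around \<open>x0\<close>, hence
  on a smaller sphere by a small multiple \<open>\<Phi>\<close> of the fundamental solution
  \<open>\<bar>x - x0\<bar>\<^bsup>-(N-p)/(p-1)\<^esup>\<close>; no strong maximum principle is needed. Since \<open>u \<ge> 0\<close> and \<open>\<Phi>\<close> tends to \<open>0\<close>,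
  the function \<open>w = ((\<Phi> - \<epsilon> - u)\<^sup>+)\<^sup>2\<close>, cut off inside the ball, is a compactly supported \<open>C\<^sup>1\<close>
  function. Testing the supersolution \<open>u\<close> and the \<open>p\<close>-harmonic function \<open>\<Phi>\<close> with \<open>w\<close>, strict
  monotonicity of \<open>z \<mapsto> \<bar>z\<bar>\<^bsup>p-2\<^esup>z\<close> gives \<open>\<nabla>w = 0\<close>, so \<open>w = 0\<close> and \<open>u \<ge> \<Phi>\<close> away from \<open>x0\<close>. Hence the
  limit inferior is positive. As the weak formulation only admits smooth test functions, \<open>w\<close> is
  mollified first, and the fundamental lemma of the calculus of variations identifies the weak
  gradient with the classical one.\<close>

subsection \<open>Calculus of \<open>C\<^sup>k\<close> functions\<close>

lemma grad_eqI:
  assumes "GDERIV f x :> D"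
  shows "grad f x = D"
proof -
  have "frechet_derivative f (at x) = (\<lambda>h. h \<bullet> D)"
    using assms frechet_derivative_at unfolding gderiv_def by metis
  then show ?thesis
    by (simp add: grad_def inner_commute[of _ D] euclidean_representation)
qed

lemma GDERIV_imp_differentiable: "GDERIV f x :> D \<Longrightarrow> f differentiable (at x)"
  unfolding gderiv_def differentiable_def by blast

lemma GDERIV_inner_left: "GDERIV (\<lambda>x. x \<bullet> c) x :> c"
  unfolding gderiv_def by (auto intro!: derivative_eq_intros)

lemma C_k_SucI:
  assumes "\<And>x. GDERIV f x :> D x" and "\<And>b. b \<in> Basis \<Longrightarrow> C_k k (\<lambda>x. D x \<bullet> b)"
  shows "C_k (Suc k) f"
proof -
  have "grad f = D" using grad_eqI[OF assms(1)] by blast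
  then show ?thesis using assms GDERIV_imp_differentiable[OF assms(1)] by auto
qed

lemma C_k_SucD_GDERIV: "C_k (Suc k) f \<Longrightarrow> GDERIV f x :> grad f x"
  using gderiv_grad by auto

lemma C_k_SucD_partial: "C_k (Suc k) f \<Longrightarrow> b \<in> Basis \<Longrightarrow> C_k k (\<lambda>x. grad f x \<bullet> b)"
  by simp

lemma C_k_Suc_imp: "C_k (Suc k) f \<Longrightarrow> C_k k f"
proof (induction k arbitrary: f)
  case 0
  then show ?case
    by (auto simp: continuous_on_eq_continuous_at intro: differentiable_imp_continuous_within)
next
  case (Suc k)
  then show ?case by (metis C_k.simps(2))
qed

lemma C_k_imp_continuous: "C_k k f \<Longrightarrow> continuous_on UNIV f"
  by (induction k) (use C_k_Suc_imp in \<open>auto simp del: C_k.simps(2)\<close>)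

lemma C_k_imp_continuous_grad:
  assumes "C_k (Suc k) f"
  shows "continuous_on UNIV (grad f)"
  using assms C_k_imp_continuous by (subst continuous_on_componentwise) auto

lemma C_k_const: "C_k k (\<lambda>x. c)"
proof (induction k arbitrary: c)
  case (Suc k)
  then show ?case by (intro C_k_SucI[OF GDERIV_const]) auto
qed auto

lemma C_k_inner_left: "C_k k (\<lambda>x. x \<bullet> c)"
proof (cases k)
  case (Suc n)
  then show ?thesis using C_k_SucI[OF GDERIV_inner_left C_k_const] by auto
qed (auto intro!: continuous_intros)

lemma C_k_add: "C_k k f \<Longrightarrow> C_k k h \<Longrightarrow> C_k k (\<lambda>x. f x + h x)"
proof (induction k arbitrary: f h)
  case 0
  then show ?case by (auto intro: continuous_on_add)
next
  case (Suc k)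
  show ?case
    by (rule C_k_SucI[OF GDERIV_add[OF C_k_SucD_GDERIV C_k_SucD_GDERIV]])
       (use Suc in \<open>auto simp: inner_add_left\<close>)
qed

lemma C_k_mult: "C_k k f \<Longrightarrow> C_k k h \<Longrightarrow> C_k k (\<lambda>x. f x * h x)"
proof (induction k arbitrary: f h)
  case 0
  then show ?case by (auto intro: continuous_on_mult)
next
  case (Suc k)
  have "C_k k f" "C_k k h" using Suc.prems C_k_Suc_imp by blast+
  then have "C_k k (\<lambda>x. f x * (grad h x \<bullet> b) + h x * (grad f x \<bullet> b))" if "b \<in> Basis" for b
    using Suc that by (intro C_k_add Suc.IH) auto
  then show ?case
    by (intro C_k_SucI[OF GDERIV_mult[OF C_k_SucD_GDERIV C_k_SucD_GDERIV]])
       (use Suc.prems in \<open>auto simp: inner_add_left\<close>)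
qed

lemma C_k_sum: "(\<And>i. i \<in> I \<Longrightarrow> C_k k (f i)) \<Longrightarrow> C_k k (\<lambda>x. \<Sum>i\<in>I. f i x)"
  by (induction I rule: infinite_finite_induct) (auto intro: C_k_const C_k_add)

lemma C_k_1_iff:
  "C_k 1 f \<longleftrightarrow> (\<forall>x. f differentiable (at x)) \<and> continuous_on UNIV (grad f)"
  unfolding One_nat_def C_k.simps by (subst (2) continuous_on_componentwise) auto

lemma C_k_1I:
  assumes "\<And>x. GDERIV f x :> D x" and "continuous_on UNIV D"
  shows "C_k 1 f"
proof -
  have "grad f = D" using grad_eqI[OF assms(1)] by blast
  then show ?thesis using assms GDERIV_imp_differentiable[OF assms(1)] by (auto simp: C_k_1_iff intro!: continuous_intros)
qed

lemma C_k_1_GDERIV: "C_k 1 f \<Longrightarrow> GDERIV f x :> grad f x"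
  unfolding One_nat_def by (rule C_k_SucD_GDERIV)

text \<open>The strict inequality leaves an open neighbourhood of x on which f is 0, so the
  derivative at x is that of a constant. This is why gradients get the support radius
  \<open>r + 1\<close> later on.\<close>

lemma grad_eq_0_outside:
  assumes "\<And>x. r \<le> norm x \<Longrightarrow> f x = 0" and "r < norm x"
  shows "grad f x = 0"
proof (rule grad_eqI)
  have "((\<lambda>x. 0) has_derivative (\<lambda>h. h \<bullet> 0)) (at x)" by simp
  moreover have "open {y. r < norm y}" by (intro open_Collect_less continuous_intros)
  ultimately have "(f has_derivative (\<lambda>h. h \<bullet> 0)) (at x)"
    by (rule has_derivative_transform_within_open) (use assms in auto)
  then show "GDERIV f x :> 0" by (simp add: gderiv_def)
qed

text \<open>Replaces the support condition of \<open>test_function\<close> by a radius, the form in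
  which compact support is handled from here on.\<close>

lemma compact_support_iff:
  "compact (closure {x::'a::euclidean_space. f x \<noteq> (0::real)}) \<longleftrightarrow> (\<exists>r>0. \<forall>x. r \<le> norm x \<longrightarrow> f x = 0)"
proof
  assume "compact (closure {x. f x \<noteq> 0})"
  then have "bounded {x. f x \<noteq> 0}" by (meson bounded_subset closure_subset compact_imp_bounded)
  then obtain r where "r > 0" "\<forall>x\<in>{x. f x \<noteq> 0}. norm x < r" unfolding bounded_pos_less by blast
  then show "\<exists>r>0. \<forall>x. r \<le> norm x \<longrightarrow> f x = 0" by (intro exI[of _ r]) force
next
  assume "\<exists>r>0. \<forall>x. r \<le> norm x \<longrightarrow> f x = 0"
  then obtain r where "\<forall>x. r \<le> norm x \<longrightarrow> f x = 0" by blast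
  then have "{x. f x \<noteq> 0} \<subseteq> cball 0 r" by (force simp: dist_norm)
  then show "compact (closure {x. f x \<noteq> 0})"
    by (meson bounded_cball bounded_subset compact_closure)
qed

subsection \<open>Smooth bump functions\<close>

text \<open>All derivatives of exp(-1/t), extended by 0 to t <= 0, have this form. Carrying the
  polynomial q along keeps the family closed under differentiation, so that smoothness is a single
  induction.\<close>

definition flat :: "real poly \<Rightarrow> real \<Rightarrow> real" where
  "flat q t = (if t > 0 then poly q (1 / t) * exp (- (1 / t)) else 0)"

lemma poly_mult_exp_minus_tendsto_0: "((\<lambda>s::real. poly q s * exp (- s)) \<longlongrightarrow> 0) at_top"
proof -
  have "((\<lambda>s::real. \<Sum>i\<le>degree q. coeff q i * (s ^ i / exp s)) \<longlongrightarrow> (\<Sum>i\<le>degree q. coeff q i * 0)) at_top"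
    by (intro tendsto_intros tendsto_power_div_exp_0)
  then show ?thesis
    by (simp add: poly_altdef sum_divide_distrib exp_minus field_simps)
qed

lemma flat_tendsto_0: "(flat q \<longlongrightarrow> 0) (at 0)"
proof -
  have "((\<lambda>t. poly q (inverse t) * exp (- inverse t)) \<longlongrightarrow> 0) (at_right (0::real))"
    by (rule filterlim_compose[OF poly_mult_exp_minus_tendsto_0 filterlim_inverse_at_top_right])
  then have "(flat q \<longlongrightarrow> 0) (at_right 0)"
    by (rule Lim_transform_eventually)
       (auto simp: flat_def eventually_at_filter field_simps)
  moreover have "(flat q \<longlongrightarrow> 0) (at_left 0)"
    by (rule Lim_transform_eventually[OF tendsto_const])
       (auto simp: flat_def eventually_at_filter)
  ultimately show ?thesis by (simp add: filterlim_split_at)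
qed

text \<open>For s = 1/t one has ds/dt = -s^2, and q(s) exp(-s) has the s-derivative (q' - q)(s)
  exp(-s). The factor \<open>[:0, 0, 1:]\<close> is X^2.\<close>

lemma DERIV_flat: "DERIV (flat q) t :> flat ([:0, 0, 1:] * (q - pderiv q)) t"
proof (cases t "0::real" rule: linorder_cases)
  case less
  have "DERIV (\<lambda>x. 0) t :> 0" by simp
  moreover have "open {x. x < (0::real)}" by (intro open_Collect_less continuous_intros)
  ultimately have "DERIV (flat q) t :> 0"
    unfolding has_field_derivative_def
    by (rule has_derivative_transform_within_open)
       (use less in \<open>auto simp: flat_def\<close>)
  then show ?thesis using less by (simp add: flat_def)
next
  case equal
  \<comment> \<open>The difference quotient at 0 is \<open>flat q h / h\<close>, and dividing by h
    multiplies the polynomial in 1/h by X.\<close>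
  have "((\<lambda>h. flat ([:0, 1:] * q) h) \<longlongrightarrow> 0) (at 0)" by (rule flat_tendsto_0)
  then have "((\<lambda>h. (flat q (0 + h) - flat q 0) / h) \<longlongrightarrow> 0) (at 0)"
    by (rule Lim_transform_eventually)
       (auto simp: flat_def eventually_at_filter)
  then show ?thesis using equal by (simp add: DERIV_def flat_def)
next
  case greater
  have "DERIV (\<lambda>t. poly q (1 / t) * exp (- (1 / t))) t :>
      poly ([:0, 0, 1:] * (q - pderiv q)) (1 / t) * exp (- (1 / t))"
    using greater
    by (auto intro!: derivative_eq_intros DERIV_chain2[where f="poly q"] poly_DERIV
        simp: power2_eq_square field_simps)
  moreover have "open {x. (0::real) < x}" by (intro open_Collect_less continuous_intros)
  ultimately have "DERIV (flat q) t :>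
      poly ([:0, 0, 1:] * (q - pderiv q)) (1 / t) * exp (- (1 / t))"
    unfolding has_field_derivative_def
    by (rule has_derivative_transform_within_open)
       (use greater in \<open>auto simp: flat_def\<close>)
  then show ?thesis using greater by (simp add: flat_def)
qed

text \<open>Induction on k with q arbitrary: by the chain rule each partial derivative is a member
  of the same family, composed with s, times a partial derivative of s.\<close>

lemma C_k_flat_compose:
  assumes "\<And>k. C_k k s"
  shows "C_k k (\<lambda>x. flat q (s x))"
proof (induction k arbitrary: q)
  case 0
  have "continuous_on UNIV (flat q)" by (meson DERIV_continuous_on DERIV_flat has_field_derivative_at_within)
  then show ?case
    using C_k_imp_continuous[OF assms] by (auto intro: continuous_on_compose2)
next
  case (Suc k)
  have "GDERIV (\<lambda>x. flat q (s x)) x :>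
      flat ([:0, 0, 1:] * (q - pderiv q)) (s x) *\<^sub>R grad s x" for x
    by (rule GDERIV_DERIV_compose[OF C_k_SucD_GDERIV[OF assms] DERIV_flat])
  then show ?case
    by (rule C_k_SucI)
       (use assms[of "Suc k"] Suc.IH in \<open>auto simp del: mult_pCons_left intro!: C_k_mult\<close>)
qed

subsection \<open>Integrals of compactly supported functions\<close>

lemma integrable_lebesgue_compact_support:
  fixes f :: "'a::euclidean_space \<Rightarrow> 'b::euclidean_space"
  assumes "continuous_on UNIV f" and "\<And>x. r \<le> norm x \<Longrightarrow> f x = 0"
  shows "integrable lebesgue f"
proof -
  have "integrable lborel (\<lambda>x. indicator (cball 0 r) x *\<^sub>R f x)"
    by (rule borel_integrable_compact) (auto intro: continuous_on_subset[OF assms(1)])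
  also have "(\<lambda>x. indicator (cball 0 r) x *\<^sub>R f x) = f"
    using assms(2) by (force simp: indicator_def)
  finally show ?thesis by (simp add: integrable_completion borel_measurable_integrable)
qed

text \<open>Passes to the gauge integral over a box, for which differentiation under the integral
  sign and the vanishing criterion \<open>integral_cbox_eq_0_iff\<close> are available.\<close>

lemma lebesgue_integral_eq_integral_cbox:
  fixes f :: "'a::euclidean_space \<Rightarrow> real"
  assumes "integrable lebesgue f" and "\<And>x. x \<notin> cbox a b \<Longrightarrow> f x = 0"
  shows "(\<integral>x. f x \<partial>lebesgue) = integral (cbox a b) f"
proof -
  have "(\<lambda>x. indicator (cbox a b) x *\<^sub>R f x) = f"
    using assms(2) by (force simp: indicator_def)
  then show ?thesis
    using set_lebesgue_integral_eq_integral(2)[of "cbox a b" f] assms(1)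
    by (simp add: set_lebesgue_integral_def set_integrable_def)
qed

lemma lebesgue_integral_translation:
  fixes f :: "'a::euclidean_space \<Rightarrow> 'b::euclidean_space"
  assumes "continuous_on UNIV f"
  shows "(\<integral>x. f (a + x) \<partial>lebesgue) = (\<integral>x. f x \<partial>lebesgue)"
proof -
  have [measurable]: "f \<in> borel_measurable borel"
    using assms by (rule borel_measurable_continuous_onI)
  have "(\<integral>x. f x \<partial>lborel) = (\<integral>x. f x \<partial>distr lborel borel ((+) a))"
    by (simp only: lborel_distr_plus)
  also have "\<dots> = (\<integral>x. f (a + x) \<partial>lborel)"
    by (rule integral_distr) auto
  finally show ?thesis by (simp add: integral_completion)
qed

lemma bounded_compact_support:
  fixes D :: "'a::euclidean_space \<Rightarrow> 'b::real_normed_vector"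
  assumes "continuous_on UNIV D" and "\<And>x. r < norm x \<Longrightarrow> D x = 0"
  shows "\<exists>M>0. \<forall>x. norm (D x) \<le> M"
proof -
  have "bounded (D ` cball 0 r)"
    by (intro compact_imp_bounded compact_continuous_image continuous_on_subset[OF assms(1)]) auto
  then obtain M where "M > 0" "\<forall>y\<in>D ` cball 0 r. norm y \<le> M" unfolding bounded_pos by blast
  moreover have "norm (D x) \<le> M" for x
    using calculation assms(2) by (cases "r < norm x") auto
  ultimately show ?thesis by blast
qed

text \<open>By translation invariance the difference quotients of f in direction a have integral 0,
  and dominated convergence carries this over to the directional derivative. This plays the role of
  the divergence theorem in all that follows.\<close>

lemma integral_gradient_eq_0:
  fixes f :: "'a::euclidean_space \<Rightarrow> real"
  assumes f: "C_k 1 f" and supp: "\<And>x. r \<le> norm x \<Longrightarrow> f x = 0"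
  shows "(\<integral>x. grad f x \<bullet> a \<partial>lebesgue) = 0"
proof -
  have contf: "continuous_on UNIV f" using f by (rule C_k_imp_continuous)
  have contD: "continuous_on UNIV (grad f)" using f C_k_1_iff by blast
  obtain M where M: "M > 0" "\<And>x. norm (grad f x) \<le> M"
    using bounded_compact_support[OF contD grad_eq_0_outside[of r f]] supp by blast
  define q where "q n x = (f (a /\<^sub>R real (Suc n) + x) - f x) * real (Suc n)" for n x
  have contq: "continuous_on UNIV (q n)" for n
    unfolding q_def by (intro continuous_intros continuous_on_compose2[OF contf]) auto
  have "integrable lebesgue (\<lambda>x. f (b + x))" for b
    by (rule integrable_lebesgue_compact_support[of _ "r + norm b"])
       (auto intro!: continuous_intros continuous_on_compose2[OF contf] supp,
        smt (verit) add.commute norm_diff_ineq)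
  from this this[of 0] have int0: "(\<integral>x. q n x \<partial>lebesgue) = 0" for n
    unfolding q_def using lebesgue_integral_translation[OF contf]
    by (simp add: Bochner_Integration.integral_diff)
  \<comment> \<open>Mean value inequality with the gradient bound M. It makes the difference
    quotients bounded by \<open>M * norm a\<close>, uniformly in n.\<close>
  have lip: "\<bar>f (y + x) - f x\<bar> \<le> M * norm y" for x y
  proof -
    have "norm (f (y + x) - f x) \<le> M * norm (y + x - x)"
    proof (rule differentiable_bound[of UNIV])
      show "(f has_derivative (\<lambda>h. h \<bullet> grad f z)) (at z within UNIV)" for z
        using C_k_1_GDERIV[OF f] unfolding gderiv_def by simp
      show "onorm (\<lambda>h. h \<bullet> grad f z) \<le> M" for z
      proof (rule onorm_bound)
        show "norm (h \<bullet> grad f z) \<le> M * norm h" for h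
          using Cauchy_Schwarz_ineq2[of h "grad f z"] mult_left_mono[OF M(2)[of z] norm_ge_zero[of h]]
          by (simp add: mult.commute)
      qed (use M in auto)
    qed auto
    then show ?thesis by simp
  qed
  have qM: "\<bar>q n x\<bar> \<le> M * norm a" for n x
  proof -
    have "\<bar>q n x\<bar> \<le> M * norm (a /\<^sub>R real (Suc n)) * real (Suc n)"
      unfolding q_def abs_mult abs_of_nat by (intro mult_right_mono lip) simp
    also have "\<dots> = M * norm a" by (simp del: of_nat_Suc)
    finally show ?thesis .
  qed
  \<comment> \<open>The step 1/(n+1) is at most 1, so all quotients vanish outside one common ball,
    whose radius exceeds r by \<open>norm a\<close>.\<close>
  have q0: "q n x = 0" if "r + norm a \<le> norm x" for n x
  proof -
    have "norm (a /\<^sub>R real (Suc n)) \<le> norm a" using mult_left_le_one_le[of "norm a" "inverse (real (Suc n))"]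
      by (simp add: field_simps)
    then have "r \<le> norm (a /\<^sub>R real (Suc n) + x)"
      using that norm_diff_ineq[of x "a /\<^sub>R real (Suc n)"] by (simp add: add.commute)
    moreover have "r \<le> norm x" using that norm_ge_zero[of a] by linarith
    ultimately show ?thesis using supp by (simp add: q_def)
  qed
  have "(\<lambda>n. \<integral>x. q n x \<partial>lebesgue) \<longlonglongrightarrow> (\<integral>x. grad f x \<bullet> a \<partial>lebesgue)"
  proof (rule integral_dominated_convergence[where w = "\<lambda>x. M * norm a * indicator (cball 0 (r + norm a)) x"])
    show "(\<lambda>x. grad f x \<bullet> a) \<in> borel_measurable lebesgue"
      by (intro measurable_completion) (auto intro!: borel_measurable_continuous_onI continuous_intros contD)
    show "q n \<in> borel_measurable lebesgue" for n
      using borel_measurable_continuous_onI[OF contq] by (auto intro: measurable_completion)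
    show "integrable lebesgue (\<lambda>x::'a. M * norm a * indicator (cball 0 (r + norm a)) x)"
      using emeasure_bounded_finite[of "cball (0::'a) (r + norm a)"]
      by (intro integrable_mult_right integrable_real_indicator) auto
    have "(\<lambda>n. q n x) \<longlonglongrightarrow> grad f x \<bullet> a" for x
    proof -
      have "((\<lambda>t. f (x + t *\<^sub>R a)) has_derivative (\<lambda>t. (t *\<^sub>R a) \<bullet> grad f x)) (at 0)"
        by (rule has_derivative_compose[of "\<lambda>t. x + t *\<^sub>R a", where g = f])
           (use C_k_1_GDERIV[OF f, of x] in \<open>auto simp: gderiv_def intro!: derivative_eq_intros\<close>)
      then have "DERIV (\<lambda>t. f (x + t *\<^sub>R a)) 0 :> a \<bullet> grad f x"
        unfolding has_field_derivative_def by (rule has_derivative_eq_rhs) (auto simp: mult.commute)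
      then have *: "((\<lambda>t. (f (x + t *\<^sub>R a) - f x) / t) \<longlongrightarrow> a \<bullet> grad f x) (at 0)"
        by (simp add: DERIV_def)
      have "filterlim (\<lambda>n. inverse (real (Suc n))) (at 0) sequentially"
        using LIMSEQ_inverse_real_of_nat by (simp add: filterlim_at)
      from filterlim_compose[OF * this] show ?thesis
        by (simp add: q_def add.commute inner_commute divide_inverse)
    qed
    then show "AE x in lebesgue. (\<lambda>n. q n x) \<longlonglongrightarrow> grad f x \<bullet> a" by simp
    show "AE x in lebesgue. norm (q n x) \<le> M * norm a * indicator (cball 0 (r + norm a)) x" for n
      using qM q0 by (intro AE_I2) (force simp: indicator_def)
  qed
  then show ?thesis unfolding int0 using LIMSEQ_unique tendsto_const by blast
qed

text \<open>The product of f and h inherits the compact support of h, so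
  \<open>integral_gradient_eq_0\<close> applies to it; the product rule splits the integral.\<close>

lemma integral_by_parts_partial:
  fixes f h :: "'a::euclidean_space \<Rightarrow> real"
  assumes f: "C_k 1 f" and h: "C_k 1 h" and supp: "\<And>x. r \<le> norm x \<Longrightarrow> h x = 0"
  shows "(\<integral>x. f x * (grad h x \<bullet> a) \<partial>lebesgue) = - (\<integral>x. (grad f x \<bullet> a) * h x \<partial>lebesgue)"
proof -
  have cont: "continuous_on UNIV f" "continuous_on UNIV h"
      "continuous_on UNIV (grad f)" "continuous_on UNIV (grad h)"
    using f h C_k_imp_continuous C_k_1_iff by blast+
  have gradh: "grad h x = 0" if "r < norm x" for x
    using grad_eq_0_outside[of r h] supp that by blast
  have "GDERIV (\<lambda>x. f x * h x) x :> f x *\<^sub>R grad h x + h x *\<^sub>R grad f x" for x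
    by (intro GDERIV_mult C_k_1_GDERIV f h)
  note G = grad_eqI[OF this]
  have "(\<integral>x. grad (\<lambda>x. f x * h x) x \<bullet> a \<partial>lebesgue) = 0"
    by (rule integral_gradient_eq_0[of _ r]) (auto intro: C_k_mult f h simp: supp simp del: One_nat_def)
  then have "(\<integral>x. f x * (grad h x \<bullet> a) + (grad f x \<bullet> a) * h x \<partial>lebesgue) = 0"
    unfolding G by (simp add: inner_add_left mult.commute)
  moreover have "integrable lebesgue (\<lambda>x. f x * (grad h x \<bullet> a))"
    by (rule integrable_lebesgue_compact_support[of _ "r + 1"])
       (use cont in \<open>auto intro!: continuous_intros simp: gradh\<close>)
  moreover have "integrable lebesgue (\<lambda>x. (grad f x \<bullet> a) * h x)"
    by (rule integrable_lebesgue_compact_support[of _ r])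
       (use cont supp in \<open>auto intro!: continuous_intros\<close>)
  ultimately show ?thesis by simp
qed

subsection \<open>Mollification\<close>

text \<open>Differentiation under the integral sign over a fixed box. \<open>leibniz_rule\<close>
  takes the derivative as a bounded linear map, so the gradient is wrapped by
  \<open>blinfun_inner_left\<close> and read off again coordinate by coordinate.\<close>

lemma GDERIV_convolution_cbox:
  fixes \<psi> \<rho> :: "'a::euclidean_space \<Rightarrow> real"
  assumes \<rho>: "C_k 1 \<rho>" and \<psi>: "continuous_on UNIV \<psi>"
  shows "GDERIV (\<lambda>x. integral (cbox a b) (\<lambda>y. \<rho> (x - y) * \<psi> y)) x :>
    (\<Sum>c\<in>Basis. integral (cbox a b) (\<lambda>y. (grad \<rho> (x - y) \<bullet> c) * \<psi> y) *\<^sub>R c)" (is "GDERIV ?F x :> ?G")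
proof -
  let ?D = "\<lambda>x y. \<psi> y *\<^sub>R blinfun_inner_left (grad \<rho> (x - y))"
  have cont: "continuous_on UNIV \<rho>" "continuous_on UNIV (grad \<rho>)"
    using \<rho> C_k_imp_continuous C_k_1_iff by blast+
  have contD: "continuous_on (UNIV \<times> cbox a b) (\<lambda>(x, y). ?D x y)"
    unfolding case_prod_beta
    by (intro continuous_intros bounded_linear.continuous_on[OF bounded_linear_blinfun_inner_left]
        continuous_on_compose2[OF cont(2)] continuous_on_compose2[OF \<psi>]) auto
  have intD: "?D x integrable_on cbox a b"
    by (intro integrable_continuous continuous_intros bounded_linear.continuous_on[OF bounded_linear_blinfun_inner_left]
        continuous_on_compose2[OF cont(2)] continuous_on_subset[OF \<psi>]) auto
  have d: "((\<lambda>x. \<rho> (x - y) * \<psi> y) has_derivative blinfun_apply (?D x y)) (at x within UNIV)" for x y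
  proof -
    have "((\<lambda>x. \<rho> (x - y)) has_derivative (\<lambda>h. h \<bullet> grad \<rho> (x - y))) (at x)"
      by (rule has_derivative_compose[of "\<lambda>x. x - y", where g = \<rho>])
         (use C_k_1_GDERIV[OF \<rho>] in \<open>auto simp: gderiv_def intro!: derivative_eq_intros\<close>)
    then show ?thesis
      by (intro has_derivative_eq_rhs[OF has_derivative_mult_left])
         (auto simp: fun_eq_iff blinfun.scaleR_left)
  qed
  have "(?F has_derivative blinfun_apply (integral (cbox a b) (?D x))) (at x within UNIV)"
    by (rule leibniz_rule[OF d _ contD])
       (auto intro!: integrable_continuous continuous_intros
         continuous_on_compose2[OF cont(1)] continuous_on_subset[OF \<psi>])
  moreover have "blinfun_apply (integral (cbox a b) (?D x)) = (\<lambda>h. h \<bullet> ?G)"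
  proof
    fix h
    have gi: "(\<lambda>y. (grad \<rho> (x - y) \<bullet> c) * \<psi> y) integrable_on cbox a b" for c
      by (auto intro!: integrable_continuous continuous_intros
         continuous_on_compose2[OF cont(2)] continuous_on_subset[OF \<psi>])
    have "blinfun_apply (integral (cbox a b) (?D x)) h
        = integral (cbox a b) (\<lambda>y. \<psi> y * (h \<bullet> grad \<rho> (x - y)))"
      using blinfun_apply_integral[OF intD] by (simp add: blinfun.scaleR_left)
    also have "(\<lambda>y. \<psi> y * (h \<bullet> grad \<rho> (x - y)))
        = (\<lambda>y. \<Sum>c\<in>Basis. (h \<bullet> c) * ((grad \<rho> (x - y) \<bullet> c) * \<psi> y))"
      by (subst euclidean_inner) (simp add: sum_distrib_left mult_ac)
    also have "integral (cbox a b) \<dots>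
        = (\<Sum>c\<in>Basis. (h \<bullet> c) * integral (cbox a b) (\<lambda>y. (grad \<rho> (x - y) \<bullet> c) * \<psi> y))"
      using integrable_on_mult_right[OF gi] by (subst integral_sum) auto
    also have "\<dots> = h \<bullet> ?G"
      by (simp add: inner_sum_right mult.commute)
    finally show "blinfun_apply (integral (cbox a b) (?D x)) h = h \<bullet> ?G" .
  qed
  ultimately show ?thesis unfolding gderiv_def by simp
qed

text \<open>Induction on k with \<rho> arbitrary: a partial derivative of the convolution is the
  convolution of the same \<psi> with a partial derivative of \<rho>.\<close>

lemma C_k_convolution_cbox:
  fixes \<psi> \<rho> :: "'a::euclidean_space \<Rightarrow> real"
  assumes "C_k k \<rho>" and \<psi>: "continuous_on UNIV \<psi>"
  shows "C_k k (\<lambda>x. integral (cbox a b) (\<lambda>y. \<rho> (x - y) * \<psi> y))"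
  using assms(1)
proof (induction k arbitrary: \<rho>)
  case 0
  then have cont: "continuous_on UNIV \<rho>" by simp
  show ?case
    unfolding C_k.simps
    by (intro integral_continuous_on_param, unfold case_prod_beta)
       (intro continuous_intros continuous_on_compose2[OF cont] continuous_on_compose2[OF \<psi>]; simp)
next
  case (Suc k)
  have "C_k 1 \<rho>"
    unfolding C_k_1_iff using Suc.prems C_k_imp_continuous_grad C_k.simps(2) by blast
  from GDERIV_convolution_cbox[OF this \<psi>] show ?case
    by (rule C_k_SucI)
       (use Suc.IH[OF C_k_SucD_partial[OF Suc.prems]] in
         \<open>simp add: inner_sum_left inner_Basis if_distrib cong: if_cong\<close>)
qed

text \<open>Evenness is part of the notion so that \<rho> (x - y), as a function of y, is a
  translate of \<rho> and has integral 1 by translation invariance alone.\<close>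

definition mollifier :: "real \<Rightarrow> ('a::euclidean_space \<Rightarrow> real) \<Rightarrow> bool" where
  "mollifier \<delta> \<rho> \<longleftrightarrow> (\<forall>k. C_k k \<rho>) \<and> (\<forall>x. \<rho> x \<ge> 0) \<and> (\<forall>x. \<rho> (- x) = \<rho> x) \<and>
     (\<forall>x. \<delta> \<le> norm x \<longrightarrow> \<rho> x = 0) \<and> (\<integral>x. \<rho> x \<partial>lebesgue) = 1"

text \<open>Normalises the classical bump exp(-1/(\<delta>^2 - |x|^2)), which is
  \<open>flat 1\<close> composed with a polynomial in the coordinates.\<close>

lemma mollifier_exists:
  assumes "\<delta> > 0"
  shows "\<exists>\<rho>::'a::euclidean_space \<Rightarrow> real. mollifier \<delta> \<rho>"
proof -
  \<comment> \<open>\<delta>^2 - |x|^2, written with sums and products of coordinates so that the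
    closure rules for \<open>C_k\<close> apply.\<close>
  define s where "s x = \<delta>\<^sup>2 + (-1) * (\<Sum>b\<in>Basis. (x \<bullet> b) * (x \<bullet> b))" for x :: 'a
  have s_eq: "s x = \<delta>\<^sup>2 - (norm x)\<^sup>2" for x
    by (simp add: s_def power2_norm_eq_inner euclidean_inner[of x x])
  define e where "e x = flat 1 (s x)" for x :: 'a
  have smooth: "C_k k e" for k
    unfolding e_def[abs_def]
    by (intro C_k_flat_compose, unfold s_def[abs_def])
       (intro C_k_add C_k_mult C_k_sum C_k_const C_k_inner_left)
  have supp: "e x = 0" if "\<delta> \<le> norm x" for x
    using power_mono[OF that, of 2] assms by (simp add: e_def s_eq flat_def not_less)
  have e_even: "e (- x) = e x" for x by (simp add: e_def s_eq)
  have nn: "e x \<ge> 0" for x by (simp add: e_def flat_def)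
  have cont: "continuous_on UNIV e" using smooth C_k_imp_continuous by blast
  have "e 0 \<noteq> 0" using assms by (simp add: e_def s_eq flat_def)
  have int: "integrable lebesgue e"
    using cont supp by (rule integrable_lebesgue_compact_support)
  define I where "I = (\<integral>x. e x \<partial>lebesgue)"
  \<comment> \<open>A nonnegative continuous function with integral 0 over a box with nonempty
    interior vanishes on that box, which contradicts \<open>e 0 \<noteq> 0\<close>.\<close>
  have "I \<noteq> 0"
  proof
    assume "I = 0"
    obtain c where c: "cball (0::'a) \<delta> \<subseteq> cbox (-c) c"
      using bounded_subset_cbox_symmetric[OF bounded_cball] by metis
    have "e x = 0" if "x \<notin> cbox (-c) c" for x
      using supp[of x] c that by (force simp: subset_iff)
    then have "integral (cbox (-c) c) e = 0"
      using lebesgue_integral_eq_integral_cbox[OF int] \<open>I = 0\<close> by (simp add: I_def)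
    moreover have "box (-c) c \<noteq> {}"
    proof -
      have "ball (0::'a) \<delta> \<subseteq> interior (cbox (-c) c)"
        using c by (intro interior_maximal) (auto intro: order_trans[OF ball_subset_cball])
      then have "0 \<in> box (-c) c" using assms by (auto simp: subset_iff)
      then show ?thesis by blast
    qed
    moreover have "0 \<in> cbox (-c) c" using c assms by auto
    ultimately show False
      using integral_cbox_eq_0_iff[of "-c" c e] continuous_on_subset[OF cont] nn \<open>e 0 \<noteq> 0\<close> by auto
  qed
  moreover have "I \<ge> 0" unfolding I_def using nn by (intro integral_nonneg_AE) auto
  ultimately have "mollifier \<delta> (\<lambda>x. inverse I * e x)"
    unfolding mollifier_def using smooth nn supp int
    by (intro conjI allI C_k_mult C_k_const smooth) (auto simp: e_even simp flip: I_def)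
  then show ?thesis by blast
qed

definition mollify :: "('a::euclidean_space \<Rightarrow> real) \<Rightarrow> ('a \<Rightarrow> real) \<Rightarrow> 'a \<Rightarrow> real" where
  "mollify \<rho> \<psi> x = (\<integral>y. \<rho> (x - y) * \<psi> y \<partial>lebesgue)"

context
  fixes \<rho> \<psi> :: "'a::euclidean_space \<Rightarrow> real" and \<delta> r :: real
  assumes \<rho>: "mollifier \<delta> \<rho>"
    and \<psi>: "continuous_on UNIV \<psi>" and supp: "\<And>x. r \<le> norm x \<Longrightarrow> \<psi> x = 0"
begin

lemma mollifier_smooth: "C_k k \<rho>" and mollifier_nonneg: "\<rho> x \<ge> 0"
  and mollifier_even: "\<rho> (- x) = \<rho> x" and mollifier_support: "\<delta> \<le> norm x \<Longrightarrow> \<rho> x = 0"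
  and mollifier_integral: "(\<integral>x. \<rho> x \<partial>lebesgue) = 1"
  using \<rho> unfolding mollifier_def by auto

lemma mollifier_continuous: "continuous_on UNIV \<rho>"
  using mollifier_smooth C_k_imp_continuous by blast

lemma integrable_mollify: "integrable lebesgue (\<lambda>y. \<rho> (x - y) * \<psi> y)"
  by (rule integrable_lebesgue_compact_support[of _ r])
     (auto intro!: continuous_intros \<psi> continuous_on_compose2[OF mollifier_continuous] simp: supp)

text \<open>One box contains the support of \<psi> for every x, so the convolution is an integral
  over that box, and all derivatives fall on \<rho>.\<close>

lemma C_k_mollify: "C_k k (mollify \<rho> \<psi>)"
proof -
  obtain c where c: "cball (0::'a) r \<subseteq> cbox (-c) c"
    using bounded_subset_cbox_symmetric[OF bounded_cball] by metis
  have "\<psi> y = 0" if "y \<notin> cbox (-c) c" for y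
    using supp[of y] c that by (force simp: subset_iff)
  then have "mollify \<rho> \<psi> = (\<lambda>x. integral (cbox (-c) c) (\<lambda>y. \<rho> (x - y) * \<psi> y))"
    unfolding mollify_def[abs_def]
    by (intro ext lebesgue_integral_eq_integral_cbox integrable_mollify) auto
  then show ?thesis using C_k_convolution_cbox[OF mollifier_smooth \<psi>] by simp
qed

lemma mollify_support: "r + \<delta> \<le> norm x \<Longrightarrow> mollify \<rho> \<psi> x = 0"
proof -
  assume x: "r + \<delta> \<le> norm x"
  have "(\<lambda>y. \<rho> (x - y) * \<psi> y) = (\<lambda>y. 0)"
  proof
    show "\<rho> (x - y) * \<psi> y = 0" for y
      using supp[of y] mollifier_support[of "x - y"] norm_triangle_ineq2[of x y] x by force
  qed
  then show ?thesis by (simp add: mollify_def)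
qed

lemma test_function_mollify: "test_function (mollify \<rho> \<psi>)"
  unfolding test_function_def compact_support_iff
proof (intro conjI allI C_k_mollify exI[of _ "max 1 (r + \<delta>)"] impI)
  show "mollify \<rho> \<psi> x = 0" if "max 1 (r + \<delta>) \<le> norm x" for x
    using that mollify_support by auto
qed auto

lemma mollify_nonneg: "(\<And>x. \<psi> x \<ge> 0) \<Longrightarrow> mollify \<rho> \<psi> x \<ge> 0"
  unfolding mollify_def using mollifier_nonneg by (intro integral_nonneg_AE) auto

text \<open>\<rho> (x - y) is a probability density in y concentrated within \<delta> of x, so
  mollifying averages nearby values of \<psi>. With a small local oscillation this yields
  convergence, with a global one a uniform bound.\<close>

lemma mollify_dist_le:
  assumes "\<And>y. norm (x - y) < \<delta> \<Longrightarrow> \<bar>\<psi> y - \<psi> x\<bar> \<le> \<epsilon>"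
  shows "\<bar>mollify \<rho> \<psi> x - \<psi> x\<bar> \<le> \<epsilon>"
proof -
  have \<rho>': "\<rho> (x - y) = \<rho> (- x + y)" for y using mollifier_even[of "x - y"] by simp
  have int1: "integrable lebesgue (\<lambda>y. \<rho> (x - y))"
  proof (rule integrable_lebesgue_compact_support[of _ "norm x + \<delta>"])
    show "\<rho> (x - y) = 0" if "norm x + \<delta> \<le> norm y" for y
      using norm_triangle_ineq2[of y x] that by (intro mollifier_support) (simp add: norm_minus_commute)
  qed (auto intro!: continuous_intros continuous_on_compose2[OF mollifier_continuous])
  have one: "(\<integral>y. \<rho> (x - y) \<partial>lebesgue) = 1"
    unfolding \<rho>' lebesgue_integral_translation[OF mollifier_continuous] by (rule mollifier_integral)
  have "mollify \<rho> \<psi> x - \<psi> x = (\<integral>y. \<rho> (x - y) * \<psi> y \<partial>lebesgue) - (\<integral>y. \<rho> (x - y) * \<psi> x \<partial>lebesgue)"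
    by (simp add: mollify_def one)
  also have "\<dots> = (\<integral>y. \<rho> (x - y) * (\<psi> y - \<psi> x) \<partial>lebesgue)"
    using integrable_mollify[of x] int1
    by (subst Bochner_Integration.integral_diff[symmetric]) (auto simp: right_diff_distrib)
  also have "norm \<dots> \<le> (\<integral>y. norm (\<rho> (x - y) * (\<psi> y - \<psi> x)) \<partial>lebesgue)"
    by (rule integral_norm_bound)
  also have "\<dots> \<le> (\<integral>y. \<rho> (x - y) * \<epsilon> \<partial>lebesgue)"
  proof (rule integral_mono)
    show "integrable lebesgue (\<lambda>y. norm (\<rho> (x - y) * (\<psi> y - \<psi> x)))"
      unfolding right_diff_distrib using integrable_mollify int1 by auto
    show "norm (\<rho> (x - y) * (\<psi> y - \<psi> x)) \<le> \<rho> (x - y) * \<epsilon>" for y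
      using assms[of y] mollifier_nonneg[of "x - y"] mollifier_support[of "x - y"]
      by (cases "norm (x - y) < \<delta>") (auto simp: abs_mult intro: mult_left_mono)
  qed (use int1 in auto)
  also have "\<dots> = \<epsilon>" by (simp add: one)
  finally show ?thesis by simp
qed

end

text \<open>Differentiating under the integral puts the derivative on \<rho>, and integration by
  parts in y moves it to \<psi>. The minus sign from the inner function x - y cancels the one from
  the integration by parts.\<close>

lemma grad_mollify:
  fixes \<rho> \<psi> :: "'a::euclidean_space \<Rightarrow> real"
  assumes \<rho>: "mollifier \<delta> \<rho>" and \<psi>: "C_k 1 \<psi>" and supp: "\<And>x. r \<le> norm x \<Longrightarrow> \<psi> x = 0"
    and b: "b \<in> Basis"
  shows "grad (mollify \<rho> \<psi>) x \<bullet> b = mollify \<rho> (\<lambda>y. grad \<psi> y \<bullet> b) x"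
proof -
  have cont\<psi>: "continuous_on UNIV \<psi>" using \<psi> by (rule C_k_imp_continuous)
  have \<rho>1: "C_k 1 \<rho>" using \<rho> mollifier_def by blast
  have cont\<rho>: "continuous_on UNIV (grad \<rho>)" using \<rho>1 C_k_1_iff by blast
  obtain c where c: "cball (0::'a) r \<subseteq> cbox (-c) c"
    using bounded_subset_cbox_symmetric[OF bounded_cball] by metis
  have out: "\<psi> y = 0" if "y \<notin> cbox (-c) c" for y
    using supp[of y] c that by (force simp: subset_iff)
  have eq: "mollify \<rho> \<psi> = (\<lambda>x. integral (cbox (-c) c) (\<lambda>y. \<rho> (x - y) * \<psi> y))"
    unfolding mollify_def[abs_def]
    by (intro ext lebesgue_integral_eq_integral_cbox integrable_mollify[OF \<rho> cont\<psi> supp]) (auto simp: out)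
  have "grad (mollify \<rho> \<psi>) x \<bullet> b = integral (cbox (-c) c) (\<lambda>y. (grad \<rho> (x - y) \<bullet> b) * \<psi> y)"
    unfolding eq grad_eqI[OF GDERIV_convolution_cbox[OF \<rho>1 cont\<psi>]]
    using b by (simp add: inner_sum_left inner_Basis if_distrib cong: if_cong)
  also have "\<dots> = (\<integral>y. (grad \<rho> (x - y) \<bullet> b) * \<psi> y \<partial>lebesgue)"
  proof (intro lebesgue_integral_eq_integral_cbox[symmetric] integrable_lebesgue_compact_support[of _ r])
    show "continuous_on UNIV (\<lambda>y. (grad \<rho> (x - y) \<bullet> b) * \<psi> y)"
      by (auto intro!: continuous_intros cont\<psi> continuous_on_compose2[OF cont\<rho>])
  qed (auto simp: out supp)
  also have "\<dots> = (\<integral>y. \<rho> (x - y) * (grad \<psi> y \<bullet> b) \<partial>lebesgue)"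
  proof -
    have G: "GDERIV (\<lambda>y. \<rho> (x - y)) y :> - grad \<rho> (x - y)" for y
    proof -
      have "((\<lambda>y. x - y) has_derivative uminus) (at y)"
        by (auto intro!: derivative_eq_intros)
      from has_derivative_compose[OF this C_k_1_GDERIV[OF \<rho>1, unfolded gderiv_def]]
      show ?thesis by (simp add: gderiv_def)
    qed
    have "C_k 1 (\<lambda>y. \<rho> (x - y))"
      by (rule C_k_1I[OF G]) (auto intro!: continuous_intros continuous_on_compose2[OF cont\<rho>])
    from integral_by_parts_partial[OF this \<psi> supp, where a = b] show ?thesis
      by (simp add: grad_eqI[OF G])
  qed
  finally show ?thesis by (simp add: mollify_def)
qed

subsection \<open>The fundamental lemma of the calculus of variations\<close>

lemma mollifier_sequence:
  obtains \<rho> :: "nat \<Rightarrow> 'a::euclidean_space \<Rightarrow> real"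
  where "\<And>n. mollifier (1 / real (Suc n)) (\<rho> n)"
proof -
  have "\<forall>n. \<exists>\<rho>::'a \<Rightarrow> real. mollifier (1 / real (Suc n)) \<rho>"
    by (intro allI mollifier_exists) simp
  then show ?thesis using that by metis
qed

context
  fixes \<rho> :: "nat \<Rightarrow> 'a::euclidean_space \<Rightarrow> real" and \<psi> :: "'a \<Rightarrow> real" and r :: real
  assumes \<rho>: "\<And>n. mollifier (1 / real (Suc n)) (\<rho> n)"
    and \<psi>: "continuous_on UNIV \<psi>" and supp: "\<And>x. r \<le> norm x \<Longrightarrow> \<psi> x = 0"
begin

lemma mollify_tendsto: "(\<lambda>n. mollify (\<rho> n) \<psi> x) \<longlonglongrightarrow> \<psi> x"
proof (rule LIMSEQ_I)
  fix e :: real assume "e > 0"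
  then obtain d where d: "d > 0" "\<And>y. dist y x < d \<Longrightarrow> dist (\<psi> y) (\<psi> x) < e / 2"
    using \<psi> unfolding continuous_on_iff by (metis UNIV_I half_gt_zero)
  obtain N where N: "1 / real (Suc N) < d" using d(1) nat_approx_posE by blast
  have "norm (mollify (\<rho> n) \<psi> x - \<psi> x) < e" if "n \<ge> N" for n
  proof -
    have "1 / real (Suc n) \<le> 1 / real (Suc N)" using that by (simp add: divide_simps)
    then have "\<bar>mollify (\<rho> n) \<psi> x - \<psi> x\<bar> \<le> e / 2"
      using d(2) N by (intro mollify_dist_le[OF \<rho> \<psi> supp])
        (force simp: dist_real_def dist_norm norm_minus_commute less_imp_le)+
    then show ?thesis using \<open>e > 0\<close> by simp
  qed
  then show "\<exists>N. \<forall>n\<ge>N. norm (mollify (\<rho> n) \<psi> x - \<psi> x) < e" by blast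
qed

text \<open>Dominated convergence: the mollifications vanish outside one ball, because their radii
  are at most 1, and share a bound; h is integrable on that ball.\<close>

lemma integral_mollify_tendsto:
  assumes h: "locally_integrable h"
  shows "(\<lambda>n. \<integral>x. h x * mollify (\<rho> n) \<psi> x \<partial>lebesgue) \<longlonglongrightarrow> (\<integral>x. h x * \<psi> x \<partial>lebesgue)"
proof -
  obtain M where M: "M > 0" "\<And>x. norm (\<psi> x) \<le> M"
    using bounded_compact_support[OF \<psi>, of r] supp by (metis less_imp_le)
  \<comment> \<open>\<psi> is bounded by M and hence oscillates by at most 2 M, so the mollification
    stays within M + 2 M.\<close>
  have bound: "\<bar>mollify (\<rho> n) \<psi> x\<bar> \<le> 3 * M" for n x
  proof -
    have "\<bar>mollify (\<rho> n) \<psi> x - \<psi> x\<bar> \<le> 2 * M"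
    proof (rule mollify_dist_le[OF \<rho> \<psi> supp])
      show "\<bar>\<psi> y - \<psi> x\<bar> \<le> 2 * M" for y
        using M(2)[of x] M(2)[of y] by simp
    qed
    then show ?thesis using M(2)[of x] by simp
  qed
  have zero: "mollify (\<rho> n) \<psi> x = 0" if "r + 1 \<le> norm x" for n x
  proof -
    have "1 / real (Suc n) \<le> 1" by simp
    then have "r + 1 / real (Suc n) \<le> norm x" using that by linarith
    then show ?thesis by (intro mollify_support[OF \<rho> \<psi> supp])
  qed
  let ?B = "cball (0::'a) (r + 1)"
  have int: "integrable lebesgue (\<lambda>x. indicator ?B x *\<^sub>R h x)"
    using h unfolding locally_integrable_def set_integrable_def by auto
  have "continuous_on UNIV (mollify (\<rho> n) \<psi>)" for n
    by (rule C_k_imp_continuous[OF C_k_mollify[OF \<rho> \<psi>, where k = 0 and r = r]]) (rule supp)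
  with \<psi> have [measurable]: "mollify (\<rho> n) \<psi> \<in> borel_measurable lebesgue" "\<psi> \<in> borel_measurable lebesgue" for n
    by (auto intro!: measurable_completion borel_measurable_continuous_onI)
  note [measurable] = borel_measurable_integrable[OF int]
  have eq1: "h x * mollify (\<rho> n) \<psi> x = (indicator ?B x *\<^sub>R h x) * mollify (\<rho> n) \<psi> x" for n x
    using zero[of x n] by (cases "x \<in> ?B") auto
  have eq2: "h x * \<psi> x = (indicator ?B x *\<^sub>R h x) * \<psi> x" for x
    using supp[of x] by (cases "x \<in> ?B") auto
  show ?thesis unfolding eq1 eq2
  proof (rule integral_dominated_convergence[where w = "\<lambda>x. norm (indicator ?B x *\<^sub>R h x) * (3 * M)"])
    show "integrable lebesgue (\<lambda>x. norm (indicator ?B x *\<^sub>R h x) * (3 * M))"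
      using int by (intro integrable_mult_left integrable_norm)
    show "AE x in lebesgue. (\<lambda>n. (indicator ?B x *\<^sub>R h x) * mollify (\<rho> n) \<psi> x)
        \<longlonglongrightarrow> (indicator ?B x *\<^sub>R h x) * \<psi> x"
      by (intro AE_I2 tendsto_intros mollify_tendsto)
    show "AE x in lebesgue. norm ((indicator ?B x *\<^sub>R h x) * mollify (\<rho> n) \<psi> x)
        \<le> norm (indicator ?B x *\<^sub>R h x) * (3 * M)" for n
      using bound by (intro AE_I2, subst norm_mult) (intro mult_left_mono; simp)
  qed measurable
qed

end

lemma integrable_mult_compact_support:
  fixes h \<psi> :: "'a::euclidean_space \<Rightarrow> real"
  assumes h: "locally_integrable h" and \<psi>: "continuous_on UNIV \<psi>" and supp: "\<And>x. r \<le> norm x \<Longrightarrow> \<psi> x = 0"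
  shows "integrable lebesgue (\<lambda>x. h x * \<psi> x)"
proof -
  obtain M where M: "M > 0" "\<And>x. norm (\<psi> x) \<le> M"
    using bounded_compact_support[OF \<psi>, of r] supp by (metis less_imp_le)
  have int: "integrable lebesgue (\<lambda>x. indicator (cball 0 r) x *\<^sub>R h x)"
    using h unfolding locally_integrable_def set_integrable_def by auto
  note [measurable] = borel_measurable_integrable[OF int]
  have [measurable]: "\<psi> \<in> borel_measurable lebesgue"
    using \<psi> by (auto intro!: measurable_completion borel_measurable_continuous_onI)
  have eq: "h x * \<psi> x = (indicator (cball 0 r) x *\<^sub>R h x) * \<psi> x" for x
    using supp[of x] by (cases "x \<in> cball 0 r") auto
  show ?thesis unfolding eq
  proof (rule Bochner_Integration.integrable_bound)
    show "integrable lebesgue (\<lambda>x. M * (indicator (cball 0 r) x *\<^sub>R h x))"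
      using int by (intro integrable_mult_right)
    show "AE x in lebesgue. norm ((indicator (cball 0 r) x *\<^sub>R h x) * \<psi> x) \<le> norm (M * (indicator (cball 0 r) x *\<^sub>R h x))"
    proof (intro AE_I2)
      fix x
      show "norm ((indicator (cball 0 r) x *\<^sub>R h x) * \<psi> x) \<le> norm (M * (indicator (cball 0 r) x *\<^sub>R h x))"
        using M(1) mult_left_mono[OF M(2)[of x], of "norm (indicator (cball 0 r) x *\<^sub>R h x)"]
        by (simp only: norm_mult mult.commute) simp
    qed
  qed measurable
qed

lemma locally_integrable_inner:
  "locally_integrable G \<Longrightarrow> locally_integrable (\<lambda>x. G x \<bullet> b)"
  unfolding locally_integrable_def set_integrable_def
  by (simp flip: inner_scaleR_left)

lemma locally_integrable_diff:
  "locally_integrable f \<Longrightarrow> locally_integrable h \<Longrightarrow> locally_integrable (\<lambda>x. f x - h x)"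
  unfolding locally_integrable_def by (auto intro: set_integral_diff)

lemma continuous_imp_locally_integrable:
  fixes f :: "'a::euclidean_space \<Rightarrow> 'b::euclidean_space"
  assumes "continuous_on UNIV f"
  shows "locally_integrable f"
  unfolding locally_integrable_def
proof (intro allI impI)
  fix K :: "'a set" assume "compact K"
  then have "integrable lborel (\<lambda>x. indicator K x *\<^sub>R f x)"
    using assms continuous_on_subset by (intro borel_integrable_compact) auto
  then show "set_integrable lebesgue K f"
    unfolding set_integrable_def by (simp add: integrable_completion borel_measurable_integrable)
qed

text \<open>The mollifications of \<psi> are test functions, so the integral against \<psi> is the
  limit of a sequence of zeros.\<close>

lemma fundamental_lemma_continuous:
  fixes h \<psi> :: "'a::euclidean_space \<Rightarrow> real"
  assumes h: "locally_integrable h" and zero: "\<And>\<phi>. test_function \<phi> \<Longrightarrow> (\<integral>x. h x * \<phi> x \<partial>lebesgue) = 0"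
    and \<psi>: "continuous_on UNIV \<psi>" and supp: "\<And>x. r \<le> norm x \<Longrightarrow> \<psi> x = 0"
  shows "(\<integral>x. h x * \<psi> x \<partial>lebesgue) = 0"
proof -
  obtain \<rho> :: "nat \<Rightarrow> 'a \<Rightarrow> real" where \<rho>: "\<And>n. mollifier (1 / real (Suc n)) (\<rho> n)"
    using mollifier_sequence by blast
  show ?thesis
    using integral_mollify_tendsto[OF \<rho> \<psi> supp h] zero[OF test_function_mollify[OF \<rho> \<psi> supp]]
    by (simp add: LIMSEQ_const_iff)
qed

text \<open>The indicator of K is the limit of continuous cut-offs that decrease linearly with the
  distance to K, at a rate tending to infinity; dominated convergence applies.\<close>

lemma fundamental_lemma_compact:
  fixes h :: "'a::euclidean_space \<Rightarrow> real"
  assumes h: "locally_integrable h" and zero: "\<And>\<phi>. test_function \<phi> \<Longrightarrow> (\<integral>x. h x * \<phi> x \<partial>lebesgue) = 0"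
    and K: "compact K"
  shows "(\<integral>x. indicator K x *\<^sub>R h x \<partial>lebesgue) = 0"
\<comment> \<open>\<open>infdist\<close> to the empty set is 0 by convention, so the cut-offs would
  be constantly 1 instead of compactly supported; this case is split off.\<close>
proof (cases "K = {}")
  case False
  obtain r where r: "\<And>x. x \<in> K \<Longrightarrow> norm x \<le> r"
    using compact_imp_bounded[OF K] unfolding bounded_iff by blast
  define \<psi> where "\<psi> n x = max 0 (1 - real (Suc n) * infdist x K)" for n x
  have cont: "continuous_on UNIV (\<psi> n)" for n
    unfolding \<psi>_def by (intro continuous_intros)
  \<comment> \<open>Beyond radius \<open>r + 1\<close> the distance to K is at least 1, where even
    the widest cut-off, n = 0, has reached 0.\<close>
  have supp: "\<psi> n x = 0" if "r + 1 \<le> norm x" for n x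
  proof -
    obtain y where y: "y \<in> K" "infdist x K = dist x y"
      using infdist_attains_inf[OF compact_imp_closed[OF K] False] by blast
    have "1 \<le> infdist x K"
      using r[OF y(1)] that norm_triangle_ineq2[of x y] by (simp add: y(2) dist_norm)
    then have "1 * 1 \<le> real (Suc n) * infdist x K" by (intro mult_mono) auto
    then show ?thesis by (simp add: \<psi>_def)
  qed
  have le1: "\<bar>\<psi> n x\<bar> \<le> 1" for n x
    using infdist_nonneg[of x K] by (simp add: \<psi>_def)
  let ?B = "cball (0::'a) (r + 1)"
  have int: "integrable lebesgue (\<lambda>x. indicator ?B x *\<^sub>R h x)"
    using h unfolding locally_integrable_def set_integrable_def by auto
  note [measurable] = borel_measurable_integrable[OF int]
  have [measurable]: "\<psi> n \<in> borel_measurable lebesgue" for n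
    using cont by (auto intro!: measurable_completion borel_measurable_continuous_onI)
  have lim: "(\<lambda>n. \<psi> n x) \<longlonglongrightarrow> indicator K x" for x
  proof (cases "x \<in> K")
    case True
    then show ?thesis by (simp add: \<psi>_def)
  next
    case notin: False
    then have pos: "infdist x K > 0"
      using in_closed_iff_infdist_zero[OF compact_imp_closed[OF K] False] infdist_nonneg[of x K] by force
    then obtain N where N: "1 / real (Suc N) < infdist x K" using nat_approx_posE by blast
    have "\<psi> n x = 0" if "n \<ge> N" for n
    proof -
      have "1 < real (Suc N) * infdist x K" using N by (simp add: field_simps)
      also have "\<dots> \<le> real (Suc n) * infdist x K" using that pos by (intro mult_right_mono) auto
      finally show ?thesis by (simp add: \<psi>_def)
    qed
    then show ?thesis using notin by (intro tendsto_eventually) (auto simp: eventually_sequentially)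
  qed
  have "(\<lambda>n. \<integral>x. (indicator ?B x *\<^sub>R h x) * \<psi> n x \<partial>lebesgue) \<longlonglongrightarrow> (\<integral>x. (indicator ?B x *\<^sub>R h x) * indicator K x \<partial>lebesgue)"
  proof (rule integral_dominated_convergence[where w = "\<lambda>x. norm (indicator ?B x *\<^sub>R h x)"])
    show "AE x in lebesgue. (\<lambda>n. (indicator ?B x *\<^sub>R h x) * \<psi> n x) \<longlonglongrightarrow> (indicator ?B x *\<^sub>R h x) * indicator K x"
      by (intro AE_I2 tendsto_intros lim)
    show "AE x in lebesgue. norm ((indicator ?B x *\<^sub>R h x) * \<psi> n x) \<le> norm (indicator ?B x *\<^sub>R h x)" for n
      using le1 by (intro AE_I2, subst norm_mult) (auto intro!: mult_left_le)
    show "integrable lebesgue (\<lambda>x. norm (indicator ?B x *\<^sub>R h x))"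
      using int by (rule integrable_norm)
    show "(\<lambda>x. indicator ?B x *\<^sub>R h x * indicator K x) \<in> borel_measurable lebesgue"
      using compact_imp_closed[OF K]
      by (intro borel_measurable_times borel_measurable_indicator borel_measurable_integrable[OF int]) auto
    show "(\<lambda>x. indicator ?B x *\<^sub>R h x * \<psi> n x) \<in> borel_measurable lebesgue" for n
      by (intro borel_measurable_times borel_measurable_integrable[OF int]) measurable
  qed
  moreover have "(\<lambda>x. (indicator ?B x *\<^sub>R h x) * \<psi> n x) = (\<lambda>x. h x * \<psi> n x)" for n
  proof
    show "(indicator ?B x *\<^sub>R h x) * \<psi> n x = h x * \<psi> n x" for x
      using supp[of x n] by (cases "x \<in> ?B") auto
  qed
  moreover have "(\<lambda>x. (indicator ?B x *\<^sub>R h x) * indicator K x) = (\<lambda>x. indicator K x *\<^sub>R h x)"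
  proof
    show "(indicator ?B x *\<^sub>R h x) * indicator K x = indicator K x *\<^sub>R h x" for x
      using r[of x] by (auto simp: indicator_def)
  qed
  moreover have "(\<integral>x. h x * \<psi> n x \<partial>lebesgue) = 0" for n
    by (rule fundamental_lemma_continuous[OF h zero cont supp])
  ultimately show ?thesis by (simp only: LIMSEQ_const_iff)
qed auto

lemma sigma_finite_lebesgue: "sigma_finite_measure (lebesgue :: 'a::euclidean_space measure)"
proof
  let ?A = "range (\<lambda>n::nat. cball (0::'a) (real n))"
  have "\<Union>?A = UNIV" by (auto simp: real_arch_simple)
  moreover have "\<forall>a\<in>?A. emeasure lebesgue a \<noteq> \<infinity>"
    using emeasure_bounded_finite[OF bounded_cball] by (auto simp: less_top)
  ultimately show "\<exists>A::'a set set. countable A \<and> A \<subseteq> sets lebesgue \<and> \<Union>A = space lebesgue \<and> (\<forall>a\<in>A. emeasure lebesgue a \<noteq> \<infinity>)"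
    by (intro exI[of _ ?A]) auto
qed

text \<open>Up to a null set, a measurable subset of a ball is an increasing union of compact sets,
  so h has integral 0 over all such subsets and vanishes almost everywhere on the ball. Countably
  many balls exhaust the space.\<close>

lemma fundamental_lemma_calculus_of_variations:
  fixes h :: "'a::euclidean_space \<Rightarrow> real"
  assumes h: "locally_integrable h" and zero: "\<And>\<phi>. test_function \<phi> \<Longrightarrow> (\<integral>x. h x * \<phi> x \<partial>lebesgue) = 0"
  shows "AE x in lebesgue. h x = 0"
proof -
  have "AE x in lebesgue. indicator (cball 0 (real m)) x *\<^sub>R h x = 0" for m :: nat
  proof (rule sigma_finite_measure.density_zero[OF sigma_finite_lebesgue])
    let ?B = "cball (0::'a) (real m)"
    show int: "integrable lebesgue (\<lambda>x. indicator ?B x *\<^sub>R h x)"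
      using h unfolding locally_integrable_def set_integrable_def by auto
    fix A :: "'a set" assume "A \<in> sets lebesgue"
    then have "A \<inter> ?B \<in> sets lebesgue" by auto
    then obtain C T where CT: "fsigma C" "T \<in> null_sets lebesgue" "C \<union> T = A \<inter> ?B" "disjnt C T"
      by (rule lebesgue_set_almost_fsigma)
    then obtain F :: "nat \<Rightarrow> 'a set" where F: "range F \<subseteq> Collect compact" "C = \<Union>(range F)"
      unfolding fsigma_Union_compact by blast
    \<comment> \<open>Finite unions make the compact pieces increasing, so that their indicators
      converge pointwise to that of C.\<close>
    define K where "K n = (\<Union>i\<le>n. F i)" for n
    have K: "compact (K n)" for n using F(1) unfolding K_def by (intro compact_UN) auto
    note [measurable] = borel_measurable_integrable[OF int]
    have "(\<lambda>n. \<integral>x. indicator (K n) x *\<^sub>R (indicator ?B x *\<^sub>R h x) \<partial>lebesgue) \<longlonglongrightarrow>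
        (\<integral>x. indicator A x *\<^sub>R (indicator ?B x *\<^sub>R h x) \<partial>lebesgue)"
    proof (rule integral_dominated_convergence[where w = "\<lambda>x. norm (indicator ?B x *\<^sub>R h x)"])
      have "AE x in lebesgue. x \<notin> T"
        using CT(2) by (rule AE_not_in)
      then show "AE x in lebesgue. (\<lambda>n. indicator (K n) x *\<^sub>R (indicator ?B x *\<^sub>R h x)) \<longlonglongrightarrow>
          indicator A x *\<^sub>R (indicator ?B x *\<^sub>R h x)"
      proof eventually_elim
        case (elim x)
        show ?case
        proof (cases "x \<in> C")
          case True
          then obtain N where "x \<in> F N" using F by blast
          then have "x \<in> K n" if "n \<ge> N" for n using that unfolding K_def by blast
          moreover have "x \<in> A" using True CT(3) by blast
          ultimately show ?thesis
            by (intro tendsto_eventually eventually_sequentiallyI[of N]) simp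
        next
          case False
          then have "x \<notin> K n" for n using F(2) unfolding K_def by blast
          moreover have "x \<notin> A \<inter> ?B" using False elim CT(3) by blast
          ultimately show ?thesis by (auto simp: indicator_def)
        qed
      qed
      show "integrable lebesgue (\<lambda>x. norm (indicator ?B x *\<^sub>R h x))"
        using int by (rule integrable_norm)
      show "AE x in lebesgue. norm (indicator (K n) x *\<^sub>R (indicator ?B x *\<^sub>R h x)) \<le> norm (indicator ?B x *\<^sub>R h x)" for n
        by (intro AE_I2) (auto simp: indicator_def)
      show "(\<lambda>x. indicat_real (K n) x *\<^sub>R (indicator ?B x *\<^sub>R h x)) \<in> borel_measurable lebesgue" for n
        using compact_imp_closed[OF K]
        by (intro borel_measurable_scaleR borel_measurable_indicator borel_measurable_integrable[OF int]) auto
      show "(\<lambda>x. indicat_real A x *\<^sub>R (indicator ?B x *\<^sub>R h x)) \<in> borel_measurable lebesgue"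
        using \<open>A \<in> sets lebesgue\<close>
        by (intro borel_measurable_scaleR borel_measurable_indicator borel_measurable_integrable[OF int])
    qed
    moreover have "(\<lambda>x. indicator (K n) x *\<^sub>R (indicator ?B x *\<^sub>R h x)) = (\<lambda>x. indicator (K n) x *\<^sub>R h x)" for n
    proof
      show "indicator (K n) x *\<^sub>R (indicator ?B x *\<^sub>R h x) = indicator (K n) x *\<^sub>R h x" for x
        using CT(3) F(2) unfolding K_def indicator_def by auto
    qed
    ultimately show "set_lebesgue_integral lebesgue A (\<lambda>x. indicator ?B x *\<^sub>R h x) = 0"
      by (simp only: fundamental_lemma_compact[OF h zero K] LIMSEQ_const_iff set_lebesgue_integral_def)
  qed
  then have "AE x in lebesgue. \<forall>m::nat. indicator (cball 0 (real m)) x *\<^sub>R h x = 0"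
    unfolding AE_all_countable by blast
  then show ?thesis
  proof eventually_elim
    case (elim x)
    obtain m :: nat where "norm x \<le> real m" using real_arch_simple by blast
    then show ?case using elim[rule_format, of m] by simp
  qed
qed

section \<open>Weak and classical gradients\<close>

text \<open>By integration by parts the classical gradient satisfies the defining identity of the
  weak one, so each coordinate of the difference is annihilated by all test functions.\<close>

lemma weak_gradient_unique_C1:
  fixes u :: "'a::euclidean_space \<Rightarrow> real"
  assumes G: "weak_gradient u G" and u: "C_k 1 u"
  shows "AE x in lebesgue. G x = grad u x"
proof -
  have cont: "continuous_on UNIV (grad u)" using u C_k_1_iff by blast
  have locG: "locally_integrable G" using G weak_gradient_def by blast
  have "AE x in lebesgue. G x \<bullet> b - grad u x \<bullet> b = 0" if b: "b \<in> Basis" for b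
  proof (rule fundamental_lemma_calculus_of_variations)
    have loc: "locally_integrable (\<lambda>x. G x \<bullet> b)" "locally_integrable (\<lambda>x. grad u x \<bullet> b)"
      using locG continuous_imp_locally_integrable[OF cont] by (auto intro: locally_integrable_inner)
    then show "locally_integrable (\<lambda>x. G x \<bullet> b - grad u x \<bullet> b)" by (rule locally_integrable_diff)
    fix \<phi> :: "'a \<Rightarrow> real" assume \<phi>: "test_function \<phi>"
    then have smooth: "C_k k \<phi>" for k unfolding test_function_def by blast
    then have cont\<phi>: "continuous_on UNIV \<phi>" using C_k_imp_continuous by blast
    obtain r where r: "\<And>x. r \<le> norm x \<Longrightarrow> \<phi> x = 0"
      using \<phi> unfolding test_function_def compact_support_iff by blast
    have "(\<integral>x. (G x \<bullet> b) * \<phi> x \<partial>lebesgue) = (\<integral>x. (grad u x \<bullet> b) * \<phi> x \<partial>lebesgue)"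
      using G \<phi> b integral_by_parts_partial[OF u smooth r, where a = b] unfolding weak_gradient_def by force
    then show "(\<integral>x. (G x \<bullet> b - grad u x \<bullet> b) * \<phi> x \<partial>lebesgue) = 0"
      using integrable_mult_compact_support[OF loc(1) cont\<phi> r]
        integrable_mult_compact_support[OF loc(2) cont\<phi> r]
      by (simp add: left_diff_distrib)
  qed
  then have "AE x in lebesgue. \<forall>b\<in>Basis. G x \<bullet> b - grad u x \<bullet> b = 0"
    by (simp add: AE_ball_countable countable_finite)
  then show ?thesis by eventually_elim (auto intro: euclidean_eqI)
qed

subsection \<open>The vector field of the \<open>p\<close>-Laplacian\<close>

definition pfield :: "real \<Rightarrow> 'a::euclidean_space \<Rightarrow> 'a" where
  "pfield p z = norm z powr (p - 2) *\<^sub>R z"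

text \<open>Only z = 0 is delicate: there the factor \<open>norm z powr (p - 2)\<close> may blow up,
  but the norm of the field is \<open>norm z powr (p - 1)\<close>, which tends to 0 as p >
  1.\<close>

lemma continuous_pfield:
  assumes "1 < p"
  shows "continuous_on UNIV (pfield p)"
proof -
  have "isCont (pfield p) z" for z :: 'a
  proof (cases "z = 0")
    case False
    then show ?thesis unfolding pfield_def[abs_def] by (intro continuous_intros) auto
  next
    case True
    have "((\<lambda>z::'a. norm z powr (p - 1)) \<longlongrightarrow> norm (0::'a) powr (p - 1)) (at 0)"
      using assms by (intro tendsto_powr' tendsto_intros) auto
    moreover have "norm (pfield p z) = norm z powr (p - 1)" for z :: 'a
      using powr_mult_base[of "norm z" "p - 2"] by (simp add: pfield_def mult.commute)
    ultimately have "((\<lambda>z::'a. norm (pfield p z)) \<longlongrightarrow> 0) (at 0)" by simp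
    then show ?thesis using True by (simp add: isCont_def tendsto_norm_zero_cancel pfield_def)
  qed
  then show ?thesis by (simp add: continuous_at_imp_continuous_on)
qed

text \<open>With s = |a| and t = |b|, Cauchy-Schwarz bounds the product below by (s^(p-1) - t^(p-1))
  (s - t), which is positive for s \<noteq> t. For s = t the product equals s^(p-2) |a - b|^2. This
  treats p < 2 and p >= 2 alike.\<close>

lemma pfield_monotone:
  fixes a b :: "'a::euclidean_space"
  assumes p: "1 < p"
  shows "(pfield p a - pfield p b) \<bullet> (a - b) \<ge> 0"
    and "(pfield p a - pfield p b) \<bullet> (a - b) = 0 \<Longrightarrow> a = b"
proof -
  define s t A B where "s = norm a" and "t = norm b" and "A = s powr (p - 2)" and "B = t powr (p - 2)"
  have nn: "s \<ge> 0" "t \<ge> 0" "A \<ge> 0" "B \<ge> 0" by (simp_all add: s_def t_def A_def B_def)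
  have sq: "a \<bullet> a = s * s" "b \<bullet> b = t * t"
    by (simp_all add: s_def t_def power2_norm_eq_inner flip: power2_eq_square)
  have E: "(pfield p a - pfield p b) \<bullet> (a - b) = A * (s * s) + B * (t * t) - (A + B) * (a \<bullet> b)"
    unfolding pfield_def s_def[symmetric] t_def[symmetric] A_def[symmetric] B_def[symmetric]
    by (simp add: inner_diff_left inner_diff_right sq inner_commute[of b a] algebra_simps)
  have "(A + B) * (a \<bullet> b) \<le> (A + B) * (s * t)"
    using nn norm_cauchy_schwarz[of a b] by (intro mult_left_mono) (auto simp: s_def t_def)
  then have ge: "(A * s - B * t) * (s - t) \<le> (pfield p a - pfield p b) \<bullet> (a - b)"
    unfolding E by (simp add: algebra_simps)
  have As: "A * s = s powr (p - 1)" "B * t = t powr (p - 1)"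
    using powr_mult_base[of s "p - 2"] powr_mult_base[of t "p - 2"] nn
    by (simp_all add: A_def B_def mult.commute)
  have pos: "(A * s - B * t) * (s - t) > 0" if "s \<noteq> t"
    unfolding As using that p nn powr_less_mono2[of "p - 1" s t] powr_less_mono2[of "p - 1" t s]
    by (cases "s < t") (auto simp: zero_less_mult_iff)
  show "(pfield p a - pfield p b) \<bullet> (a - b) \<ge> 0"
    using ge pos by (cases "s = t") force+
  assume 0: "(pfield p a - pfield p b) \<bullet> (a - b) = 0"
  then have st: "s = t" using ge pos by force
  then have AB: "A = B" by (simp add: A_def B_def)
  have "(a - b) \<bullet> (a - b) = s * s + t * t - 2 * (a \<bullet> b)"
    by (simp add: inner_diff_left inner_diff_right sq inner_commute[of b a])
  then have "A * ((a - b) \<bullet> (a - b)) = 0"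
    using 0 unfolding E by (simp add: st AB)
  then consider "A = 0" | "a = b" by auto
  then show "a = b"
  proof cases
    \<comment> \<open>A real power vanishes only at base 0, so here both vectors are 0.\<close>
    case 1
    then have "s = 0" by (simp add: A_def)
    then show ?thesis using st by (simp add: s_def t_def)
  qed
qed

section \<open>Testing a supersolution with C^1 functions\<close>

text \<open>Mollifications of w are nonnegative test functions, so the inequality holds for them
  because h >= 0. Their partial derivatives are mollifications of those of w, which allows passing
  to the limit against the locally integrable flux. At the end G is replaced by the gradient of u,
  to which it is equal almost everywhere.\<close>

lemma p_Laplace_supersolution_C1:
  fixes u h :: "'a::euclidean_space \<Rightarrow> real"
  assumes p: "1 < p" and sol: "p_Laplace_weak_solution p h u" and h: "\<And>x. h x \<ge> 0" and u: "C_k 1 u"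
    and w: "C_k 1 w" and supp: "\<And>x. r \<le> norm x \<Longrightarrow> w x = 0" and nn: "\<And>x. w x \<ge> 0"
  shows "(\<integral>x. pfield p (grad u x) \<bullet> grad w x \<partial>lebesgue) \<ge> 0"
proof -
  obtain G where G: "weak_gradient u G" and loc: "locally_integrable (\<lambda>x. pfield p (G x))"
    and eq: "\<And>\<phi>. test_function \<phi> \<Longrightarrow>
      (\<integral>x. pfield p (G x) \<bullet> grad \<phi> x \<partial>lebesgue) = (\<integral>x. h x * \<phi> x \<partial>lebesgue)"
    using sol unfolding p_Laplace_weak_solution_def pfield_def by blast
  obtain \<rho> :: "nat \<Rightarrow> 'a \<Rightarrow> real" where \<rho>: "\<And>n. mollifier (1 / real (Suc n)) (\<rho> n)"
    using mollifier_sequence by blast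
  have contw: "continuous_on UNIV w" using w by (rule C_k_imp_continuous)
  have contgw: "continuous_on UNIV (\<lambda>x. grad w x \<bullet> b)" for b
    using w C_k_1_iff by (auto intro!: continuous_intros)
  have suppg: "grad w x \<bullet> b = 0" if "r + 1 \<le> norm x" for x b
    using grad_eq_0_outside[of r w x] supp that by simp
  note locb = locally_integrable_inner[OF loc]
  have int: "integrable lebesgue (\<lambda>x. (pfield p (G x) \<bullet> b) * (grad f x \<bullet> b))"
    if f: "C_k 1 f" "\<And>x. R \<le> norm x \<Longrightarrow> f x = 0" for f R b
  proof (rule integrable_mult_compact_support[OF locb])
    show "continuous_on UNIV (\<lambda>x. grad f x \<bullet> b)"
      using f(1) C_k_1_iff by (auto intro!: continuous_intros)
    show "grad f x \<bullet> b = 0" if "R + 1 \<le> norm x" for x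
      using grad_eq_0_outside[of R f x] f(2) that by simp
  qed
  \<comment> \<open>The convergence result concerns scalar functions, so the inner product is split
    into coordinates.\<close>
  have inner_sum: "(\<integral>x. pfield p (G x) \<bullet> grad f x \<partial>lebesgue)
      = (\<Sum>b\<in>Basis. \<integral>x. (pfield p (G x) \<bullet> b) * (grad f x \<bullet> b) \<partial>lebesgue)"
    if f: "C_k 1 f" "\<And>x. R \<le> norm x \<Longrightarrow> f x = 0" for f R
    using int[OF f] by (subst euclidean_inner) (simp add: Bochner_Integration.integral_sum)
  have "(\<lambda>n. \<Sum>b\<in>Basis. \<integral>x. (pfield p (G x) \<bullet> b) * mollify (\<rho> n) (\<lambda>y. grad w y \<bullet> b) x \<partial>lebesgue)
      \<longlonglongrightarrow> (\<Sum>b\<in>Basis. \<integral>x. (pfield p (G x) \<bullet> b) * (grad w x \<bullet> b) \<partial>lebesgue)"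
    by (intro tendsto_sum integral_mollify_tendsto[OF \<rho> contgw suppg locb])
  also have "(\<Sum>b\<in>Basis. \<integral>x. (pfield p (G x) \<bullet> b) * (grad w x \<bullet> b) \<partial>lebesgue)
      = (\<integral>x. pfield p (G x) \<bullet> grad w x \<partial>lebesgue)"
    using inner_sum[OF w supp] by simp
  finally have lim: "(\<lambda>n. \<Sum>b\<in>Basis. \<integral>x. (pfield p (G x) \<bullet> b) * mollify (\<rho> n) (\<lambda>y. grad w y \<bullet> b) x \<partial>lebesgue)
      \<longlonglongrightarrow> (\<integral>x. pfield p (G x) \<bullet> grad w x \<partial>lebesgue)" .
  have "0 \<le> (\<Sum>b\<in>Basis. \<integral>x. (pfield p (G x) \<bullet> b) * mollify (\<rho> n) (\<lambda>y. grad w y \<bullet> b) x \<partial>lebesgue)" for n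
  proof -
    let ?f = "mollify (\<rho> n) w"
    have "0 \<le> (\<integral>x. h x * ?f x \<partial>lebesgue)"
      using h mollify_nonneg[OF \<rho> contw supp nn] by (intro integral_nonneg_AE) auto
    also have "\<dots> = (\<integral>x. pfield p (G x) \<bullet> grad ?f x \<partial>lebesgue)"
      using eq[OF test_function_mollify[OF \<rho> contw supp]] by simp
    also have "\<dots> = (\<Sum>b\<in>Basis. \<integral>x. (pfield p (G x) \<bullet> b) * (grad ?f x \<bullet> b) \<partial>lebesgue)"
      by (rule inner_sum[OF C_k_mollify[OF \<rho> contw supp] mollify_support[OF \<rho> contw supp]])
    finally show ?thesis using grad_mollify[OF \<rho> w supp] by simp
  qed
  then have "0 \<le> (\<integral>x. pfield p (G x) \<bullet> grad w x \<partial>lebesgue)"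
    using lim by (intro LIMSEQ_le_const) auto
  also have "\<dots> = (\<integral>x. pfield p (grad u x) \<bullet> grad w x \<partial>lebesgue)"
  proof (rule integral_cong_AE)
    have "integrable lebesgue (\<lambda>x. pfield p (G x) \<bullet> grad w x)"
      using int[OF w supp] by (subst euclidean_inner) (rule Bochner_Integration.integrable_sum)
    then show "(\<lambda>x. pfield p (G x) \<bullet> grad w x) \<in> borel_measurable lebesgue"
      by (rule borel_measurable_integrable)
    have "continuous_on UNIV (\<lambda>x. pfield p (grad u x) \<bullet> grad w x)"
      using u w C_k_1_iff
      by (auto intro!: continuous_intros continuous_on_compose2[OF continuous_pfield[OF p]])
    then show "(\<lambda>x. pfield p (grad u x) \<bullet> grad w x) \<in> borel_measurable lebesgue"
      by (intro measurable_completion) (auto intro: borel_measurable_continuous_onI)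
    show "AE x in lebesgue. pfield p (G x) \<bullet> grad w x = pfield p (grad u x) \<bullet> grad w x"
      using weak_gradient_unique_C1[OF G u] by eventually_elim simp
  qed
  finally show ?thesis .
qed

subsection \<open>Comparison with the fundamental solution\<close>

lemma GDERIV_norm_powr:
  fixes x x0 :: "'a::euclidean_space"
  assumes "x \<noteq> x0"
  shows "GDERIV (\<lambda>x. norm (x - x0) powr a) x :> (a * norm (x - x0) powr (a - 2)) *\<^sub>R (x - x0)"
proof -
  have "GDERIV (\<lambda>x. norm (x - x0)) x :> sgn (x - x0)"
  proof -
    have "((\<lambda>x. x - x0) has_derivative (\<lambda>h. h)) (at x)" by (auto intro!: derivative_eq_intros)
    moreover have "(norm has_derivative (\<lambda>h. h \<bullet> sgn (x - x0))) (at (x - x0))"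
      using GDERIV_norm[of "x - x0"] assms by (simp add: gderiv_def)
    ultimately show ?thesis unfolding gderiv_def by (rule has_derivative_compose)
  qed
  moreover have "DERIV (\<lambda>t. t powr a) (norm (x - x0)) :> a * norm (x - x0) powr (a - 1)"
    using assms by (intro has_real_derivative_powr) simp
  ultimately have "GDERIV (\<lambda>x. norm (x - x0) powr a) x :> (a * norm (x - x0) powr (a - 1)) *\<^sub>R sgn (x - x0)"
    by (rule GDERIV_DERIV_compose)
  moreover have "norm (x - x0) powr (a - 1) * inverse (norm (x - x0)) = norm (x - x0) powr (a - 2)"
    using powr_mult_base[of "norm (x - x0)" "a - 2"] assms by (simp add: field_simps)
  ultimately show ?thesis by (simp add: sgn_div_norm mult.assoc)
qed

lemma GDERIV_transform_open:
  assumes "GDERIV f x :> D" "open S" "x \<in> S" "\<And>y. y \<in> S \<Longrightarrow> f y = h y"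
  shows "GDERIV h x :> D"
  using assms has_derivative_transform_within_open unfolding gderiv_def by blast

text \<open>The punctured space and a ball around x0 are open and cover everything. This removes the
  singularity at x0 from expressions multiplied by a function that vanishes near x0.\<close>

lemma continuous_on_extend_by_0:
  fixes f :: "'a::euclidean_space \<Rightarrow> 'b::real_normed_vector"
  assumes "continuous_on (- {x0}) f" and "s > 0" and "\<And>x. x \<in> ball x0 s \<Longrightarrow> f x = 0"
  shows "continuous_on UNIV f"
proof -
  have "continuous_on (ball x0 s) f"
    using assms(3) by (subst continuous_on_cong[OF refl, where g = "\<lambda>x. 0"]) auto
  then have "continuous_on (ball x0 s \<union> - {x0}) f"
    using assms(1) by (intro continuous_on_open_Un) auto
  moreover have "ball x0 s \<union> - {x0} = UNIV" using assms(2) by auto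
  ultimately show ?thesis by simp
qed

lemma grad_eq_0_ball:
  assumes "\<And>x. x \<in> ball x0 s \<Longrightarrow> f x = 0" and "x \<in> ball x0 s"
  shows "grad f x = 0"
  by (rule grad_eqI[OF GDERIV_transform_open[OF GDERIV_const[of 0] open_ball assms(2)]]) (simp only: assms(1))

text \<open>The field |x - x0|^(-N) (x - x0) is divergence free off x0, so the integrand is the
  divergence of the field times w. As w vanishes near x0, each component of this product is a
  compactly supported C^1 function, to which \<open>integral_gradient_eq_0\<close> applies.\<close>

lemma integral_radial_field_grad_eq_0:
  fixes w :: "'a::euclidean_space \<Rightarrow> real"
  defines "V \<equiv> \<lambda>x0 x::'a. norm (x - x0) powr (- real DIM('a)) *\<^sub>R (x - x0)"
  assumes w: "C_k 1 w" and supp: "\<And>x. r \<le> norm x \<Longrightarrow> w x = 0"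
    and s: "s > 0" and ball: "\<And>x. x \<in> ball x0 s \<Longrightarrow> w x = 0"
  shows "(\<integral>x. V x0 x \<bullet> grad w x \<partial>lebesgue) = 0"
proof -
  define N where "N = real DIM('a)"
  define P where "P a x = norm (x - x0) powr a" for a x
  have V: "V x0 x = P (- N) x *\<^sub>R (x - x0)" for x by (simp add: V_def P_def N_def)
  have contw: "continuous_on UNIV w" "continuous_on UNIV (grad w)"
    using w C_k_imp_continuous C_k_1_iff by blast+
  have contP: "continuous_on (- {x0}) (P a)" for a
    unfolding P_def by (intro continuous_intros) auto
  \<comment> \<open>\<open>F b\<close> is the component along b of the field times w, and
    \<open>D b\<close> is its gradient by the product rule.\<close>
  define F where "F b x = ((x - x0) \<bullet> b) * (P (- N) x * w x)" for b x
  define D where "D b x = ((x - x0) \<bullet> b) *\<^sub>R (P (- N) x *\<^sub>R grad w x + w x *\<^sub>R ((- N * P (- N - 2) x) *\<^sub>R (x - x0)))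
      + (P (- N) x * w x) *\<^sub>R b" for b x
  have grad0: "grad w x = 0" if "x \<in> ball x0 s" for x
    using grad_eq_0_ball[of x0 s w] ball that by blast
  have F: "GDERIV (F b) x :> D b x" for b x
  proof (cases "x = x0")
    case False
    have "GDERIV (\<lambda>x. (x - x0) \<bullet> b) x :> b"
      unfolding gderiv_def by (auto intro!: derivative_eq_intros)
    moreover have "GDERIV (P (- N)) x :> (- N * P (- N - 2) x) *\<^sub>R (x - x0)"
      unfolding P_def[abs_def] by (rule GDERIV_norm_powr[OF False])
    ultimately show ?thesis
      unfolding F_def[abs_def] D_def by (intro GDERIV_mult C_k_1_GDERIV[OF w])
  next
    case True
    have "GDERIV (F b) x :> 0"
      by (rule GDERIV_transform_open[OF GDERIV_const[of 0], of "ball x0 s"]) (use True s ball in \<open>auto simp: F_def\<close>)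
    moreover have "D b x = 0" using ball[of x0] s by (simp add: D_def True)
    ultimately show ?thesis by simp
  qed
  have "continuous_on UNIV (D b)" for b
  proof (rule continuous_on_extend_by_0)
    show "continuous_on (- {x0}) (D b)"
      unfolding D_def by (intro continuous_intros contP continuous_on_subset[OF contw(1)] continuous_on_subset[OF contw(2)]) auto
  qed (use s ball grad0 in \<open>auto simp: D_def\<close>)
  then have C1: "C_k 1 (F b)" for b by (intro C_k_1I[OF F])
  have gradF: "grad (F b) = D b" for b using grad_eqI[OF F] by blast
  have zero: "(\<integral>x. D b x \<bullet> b \<partial>lebesgue) = 0" for b
    using integral_gradient_eq_0[OF C1, of r b b] supp by (simp add: F_def gradF)
  have "integrable lebesgue (\<lambda>x. D b x \<bullet> b)" for b
  proof (rule integrable_lebesgue_compact_support)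
    show "continuous_on UNIV (\<lambda>x. D b x \<bullet> b)"
      using C1[of b] unfolding C_k_1_iff gradF by (intro continuous_intros) blast
    show "D b x \<bullet> b = 0" if "r + 1 \<le> norm x" for x
      using grad_eq_0_outside[of r "F b" x] supp that by (simp add: F_def gradF)
  qed
  then have "(\<integral>x. (\<Sum>b\<in>Basis. D b x \<bullet> b) \<partial>lebesgue) = 0"
    by (simp add: Bochner_Integration.integral_sum zero)
  moreover have "(\<Sum>b\<in>Basis. D b x \<bullet> b) = V x0 x \<bullet> grad w x" for x
  proof -
    \<comment> \<open>The cancellation behind vanishing divergence: the N diagonal terms contribute
      N |x - x0|^(-N), and differentiating the power contributes the negative of this. At x = x0
      both sides are 0, since 0 to any real power is 0.\<close>
    define d where "d = P (- N - 2) x * norm (x - x0)^2"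
    have d: "N * (w x * P (- N) x) = N * (w x * d)"
    proof (cases "x = x0")
      case False
      then have "P (- N) x = P (- N - 2) x * norm (x - x0) powr 2"
        unfolding P_def powr_add[symmetric] by simp
      then show ?thesis using False by (simp add: d_def)
    qed (simp add: d_def P_def)
    define y where "y b = (x - x0) \<bullet> b" for b
    define e where "e b = grad w x \<bullet> b" for b
    have "D b x \<bullet> b = y b * (P (- N) x * e b + w x * (- N * P (- N - 2) x * y b)) + P (- N) x * w x"
      if "b \<in> Basis" for b
      using that unfolding D_def y_def e_def by (simp only: inner_add_left inner_scaleR_left inner_Basis) simp
    then have "(\<Sum>b\<in>Basis. D b x \<bullet> b)
        = (\<Sum>b\<in>Basis. P (- N) x * (y b * e b) - N * w x * P (- N - 2) x * (y b * y b) + P (- N) x * w x)"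
      by (intro sum.cong) (auto simp: algebra_simps)
    also have "\<dots> = P (- N) x * (\<Sum>b\<in>Basis. y b * e b)
        - N * w x * P (- N - 2) x * (\<Sum>b\<in>Basis. y b * y b) + N * (P (- N) x * w x)"
      by (simp add: sum.distrib sum_subtractf sum_distrib_left N_def)
    also have "(\<Sum>b\<in>Basis. y b * y b) = norm (x - x0)^2"
      unfolding y_def power2_norm_eq_inner by (rule euclidean_inner[symmetric])
    also have "(\<Sum>b\<in>Basis. y b * e b) = (x - x0) \<bullet> grad w x"
      unfolding y_def e_def by (rule euclidean_inner[symmetric])
    finally have "(\<Sum>b\<in>Basis. D b x \<bullet> b) = P (- N) x * ((x - x0) \<bullet> grad w x)
        - N * (w x * d) + N * (w x * P (- N) x)"
      unfolding d_def by (simp only: mult_ac)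
    then show ?thesis using d by (simp add: V)
  qed
  ultimately show ?thesis by simp
qed

section \<open>The comparison argument\<close>

text \<open>Squaring makes the positive part C^1: the difference quotient at 0 is
  \<open>max 0 h\<close>, which tends to 0. The squared truncation is thus an admissible test
  function.\<close>

lemma DERIV_pos_part_square: "DERIV (\<lambda>t::real. (max 0 t)\<^sup>2) t :> 2 * max 0 t"
proof (cases t "0::real" rule: linorder_cases)
  case less
  have "DERIV (\<lambda>t. 0) t :> 0" by simp
  then have "DERIV (\<lambda>t::real. (max 0 t)\<^sup>2) t :> 0"
    unfolding has_field_derivative_def
    by (rule has_derivative_transform_within_open[OF _ open_lessThan[of 0]]) (use less in auto)
  then show ?thesis using less by simp
next
  case greater
  have "DERIV (\<lambda>t. t\<^sup>2) t :> 2 * t" by (auto intro!: derivative_eq_intros)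
  then have "DERIV (\<lambda>t::real. (max 0 t)\<^sup>2) t :> 2 * t"
    unfolding has_field_derivative_def
    by (rule has_derivative_transform_within_open[OF _ open_greaterThan[of 0]]) (use greater in auto)
  then show ?thesis using greater by simp
next
  case equal
  have "((\<lambda>h::real. max 0 h) \<longlongrightarrow> max 0 0) (at 0)" by (intro tendsto_intros)
  then have "((\<lambda>h::real. max 0 h) \<longlongrightarrow> 0) (at 0)" by simp
  then have "((\<lambda>h::real. (max 0 (0 + h))\<^sup>2 / h) \<longlongrightarrow> 0) (at 0)"
    by (rule Lim_transform_eventually)
       (auto simp: eventually_at_filter max_def power2_eq_square)
  then show ?thesis using equal by (simp add: DERIV_def)
qed

text \<open>The bound on u is required on a ball of twice the radius: on the annulus between s and 2
  s then \<Phi> <= m <= u, so w vanishes there and the cut-off at radius s creates no kink.\<close>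

lemma supersolution_ge_fundamental_solution:
  fixes u :: "'a::euclidean_space \<Rightarrow> real"
  defines "N \<equiv> real DIM('a)"
  assumes p: "1 < p" "p < N" and u: "C_k 1 u" and nn: "\<And>x. u x \<ge> 0"
    and super: "\<And>w r. C_k 1 w \<Longrightarrow> (\<And>x. r \<le> norm x \<Longrightarrow> w x = 0) \<Longrightarrow> (\<And>x. w x \<ge> 0) \<Longrightarrow>
       (\<integral>x. pfield p (grad u x) \<bullet> grad w x \<partial>lebesgue) \<ge> 0"
    and s: "s > 0" and m: "m > 0" and um: "\<And>x. x \<in> ball x0 (2 * s) \<Longrightarrow> m \<le> u x"
  shows "\<exists>c>0. \<forall>x. x \<notin> ball x0 s \<longrightarrow> c * norm (x - x0) powr (- ((N - p) / (p - 1))) \<le> u x"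
proof -
  define \<beta> where "\<beta> = (N - p) / (p - 1)"
  have \<beta>: "\<beta> > 0" using p by (simp add: \<beta>_def)
  \<comment> \<open>Chosen so that \<Phi> equals m on the sphere of radius s around x0.\<close>
  define c where "c = m * s powr \<beta>"
  have c: "c > 0" using m s by (simp add: c_def)
  define \<Phi> where "\<Phi> x = c * norm (x - x0) powr (- \<beta>)" for x
  define d\<Phi> where "d\<Phi> x = (- (c * \<beta>) * norm (x - x0) powr (- \<beta> - 2)) *\<^sub>R (x - x0)" for x
  have \<Phi>: "GDERIV \<Phi> x :> d\<Phi> x" if "x \<noteq> x0" for x
    using GDERIV_mult[OF GDERIV_const[of c] GDERIV_norm_powr[OF that, of "- \<beta>"]]
    by (simp add: \<Phi>_def[abs_def] d\<Phi>_def mult.assoc)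
  have \<Phi>m: "\<Phi> x \<le> m" if "x \<notin> ball x0 s" for x
  proof -
    have "s \<le> norm (x - x0)" using that by (simp add: dist_norm norm_minus_commute)
    then have "norm (x - x0) powr (- \<beta>) \<le> s powr (- \<beta>)"
      using s \<beta> by (intro powr_mono2') auto
    then have "\<Phi> x \<le> c * s powr (- \<beta>)" using c by (simp add: \<Phi>_def)
    also have "\<dots> = m" using s by (simp add: c_def powr_minus)
    finally show ?thesis .
  qed
  define K where "K = (c * \<beta>) powr (p - 1)"
  \<comment> \<open>This is the p-harmonicity of \<Phi> off x0: the choice of \<beta> makes the
    exponents add up to -N, so the flux is a multiple of the divergence-free radial field.\<close>
  have pd\<Phi>: "pfield p (d\<Phi> x) = (- K) *\<^sub>R (norm (x - x0) powr (- N) *\<^sub>R (x - x0))" if "x \<noteq> x0" for x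
  proof -
    define q where "q = norm (x - x0)"
    have q: "q > 0" using that by (simp add: q_def)
    have e: "(- \<beta> - 1) * (p - 2) + (- \<beta> - 2) = - N"
    proof -
      have "\<beta> * (p - 1) = N - p" using p by (simp add: \<beta>_def)
      then show ?thesis by (simp add: algebra_simps)
    qed
    have "norm (d\<Phi> x) = c * \<beta> * (q powr (- \<beta> - 2) * q)"
      using c \<beta> by (simp add: d\<Phi>_def q_def abs_mult)
    also have "q powr (- \<beta> - 2) * q = q powr (- \<beta> - 1)"
    proof -
      have "q powr (- \<beta> - 2) * q powr 1 = q powr (- \<beta> - 1)"
        unfolding powr_add[symmetric] by (rule arg_cong[where f = "\<lambda>a. q powr a"]) simp
      then show ?thesis using q by simp
    qed
    finally have "norm (d\<Phi> x) powr (p - 2) = (c * \<beta>) powr (p - 2) * q powr ((- \<beta> - 1) * (p - 2))"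
      using c \<beta> q by (simp add: powr_mult powr_powr)
    then have "norm (d\<Phi> x) powr (p - 2) * (- (c * \<beta>) * q powr (- \<beta> - 2))
        = - ((c * \<beta>) * (c * \<beta>) powr (p - 2)) * (q powr ((- \<beta> - 1) * (p - 2)) * q powr (- \<beta> - 2))"
      by (simp only: mult_ac mult_minus_left mult_minus_right)
    also have "(c * \<beta>) * (c * \<beta>) powr (p - 2) = K"
      using powr_mult_base[of "c * \<beta>" "p - 2"] c \<beta> by (simp add: K_def)
    also have "q powr ((- \<beta> - 1) * (p - 2)) * q powr (- \<beta> - 2) = q powr (- N)"
      unfolding powr_add[symmetric] e ..
    finally have "norm (d\<Phi> x) powr (p - 2) * (- (c * \<beta>) * q powr (- \<beta> - 2)) = - K * q powr (- N)" .
    then show ?thesis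
      unfolding pfield_def by (subst (2) d\<Phi>_def) (simp add: q_def)
  qed
  have contu: "continuous_on UNIV u" "continuous_on UNIV (grad u)"
    using u C_k_imp_continuous C_k_1_iff by blast+
  \<comment> \<open>Subtracting \<epsilon> gives the truncation compact support, since \<Phi> decays
    and u >= 0; \<epsilon> is sent to 0 at the end.\<close>
  have "\<Phi> x - \<epsilon> - u x \<le> 0" if \<epsilon>: "\<epsilon> > 0" and "x \<notin> ball x0 s" for \<epsilon> x
  proof -
    define v where "v x = \<Phi> x - \<epsilon> - u x" for x
    have v: "GDERIV v x :> d\<Phi> x - grad u x" if "x \<noteq> x0" for x
      using GDERIV_diff[OF GDERIV_diff[OF \<Phi>[OF that] GDERIV_const[of \<epsilon>]] C_k_1_GDERIV[OF u]]
      by (simp add: v_def[abs_def])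
    define w where "w x = (if x \<in> ball x0 s then 0 else (max 0 (v x))\<^sup>2)" for x
    define D where "D x = (if x \<in> ball x0 s then 0 else (2 * max 0 (v x)) *\<^sub>R (d\<Phi> x - grad u x))" for x
    have v_neg: "v x \<le> 0" if "x \<notin> ball x0 s" "x \<in> ball x0 (2 * s)" for x
      using \<Phi>m[OF that(1)] um[OF that(2)] \<epsilon> by (simp add: v_def)
    have w0: "w x = 0" and D0: "D x = 0" if "x \<in> ball x0 (2 * s)" for x
      using v_neg[of x] that by (auto simp: w_def D_def)
    have outer: "open (- cball x0 s)" by auto
    have ne: "x \<noteq> x0" and nb: "x \<notin> ball x0 s" if "x \<in> - cball x0 s" for x
      using that s by auto
    \<comment> \<open>Two overlapping open sets: w vanishes on the first and is the squared positive
      part of v on the second. The C^1 property is checked on each.\<close>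
    have cover: "x \<in> ball x0 (2 * s) \<or> x \<in> - cball x0 s" for x using s by auto
    have w: "GDERIV w x :> D x" for x
      using cover[of x]
    proof
      assume "x \<in> ball x0 (2 * s)"
      then show ?thesis
        unfolding D0[OF \<open>x \<in> ball x0 (2 * s)\<close>]
        by (rule GDERIV_transform_open[OF GDERIV_const[of 0] open_ball]) (simp only: w0)
    next
      assume x: "x \<in> - cball x0 s"
      have "GDERIV (\<lambda>x. (max 0 (v x))\<^sup>2) x :> (2 * max 0 (v x)) *\<^sub>R (d\<Phi> x - grad u x)"
        by (rule GDERIV_DERIV_compose[OF v[OF ne[OF x]] DERIV_pos_part_square])
      then have "GDERIV w x :> (2 * max 0 (v x)) *\<^sub>R (d\<Phi> x - grad u x)"
        by (rule GDERIV_transform_open[OF _ outer x]) (use nb in \<open>auto simp: w_def\<close>)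
      then show ?thesis using nb[OF x] by (simp add: D_def)
    qed
    have contv: "continuous_on (- {x0}) v" "continuous_on (- {x0}) d\<Phi>"
      unfolding v_def[abs_def] \<Phi>_def d\<Phi>_def[abs_def]
      by (intro continuous_intros continuous_on_subset[OF contu(1)]; simp)+
    have contD: "continuous_on UNIV D"
    proof -
      have "continuous_on (ball x0 (2 * s)) D"
        using D0 by (subst continuous_on_cong[OF refl, where g = "\<lambda>x. 0"]) auto
      moreover have "continuous_on (- cball x0 s) D"
      proof (subst continuous_on_cong[OF refl])
        show "D x = (2 * max 0 (v x)) *\<^sub>R (d\<Phi> x - grad u x)" if "x \<in> - cball x0 s" for x
          using nb[OF that] by (simp add: D_def)
        show "continuous_on (- cball x0 s) (\<lambda>x. (2 * max 0 (v x)) *\<^sub>R (d\<Phi> x - grad u x))"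
          by (intro continuous_intros continuous_on_subset[OF contu(2)]
              continuous_on_subset[OF contv(1)] continuous_on_subset[OF contv(2)]) (use s in auto)
      qed
      ultimately have "continuous_on (ball x0 (2 * s) \<union> - cball x0 s) D"
        by (intro continuous_on_open_Un) auto
      moreover have "ball x0 (2 * s) \<union> - cball x0 s = UNIV" using cover by blast
      ultimately show ?thesis by simp
    qed
    have C1w: "C_k 1 w" using w contD by (rule C_k_1I)
    have gradw: "grad w = D" using grad_eqI[OF w] by blast
    \<comment> \<open>At distance (c/\<epsilon>)^(1/\<beta>) from x0 the function \<Phi> has dropped
      to \<epsilon>; adding \<open>norm x0\<close> recentres the ball at the origin.\<close>
    define r where "r = norm x0 + (c / \<epsilon>) powr (1 / \<beta>)"
    have supp: "w x = 0" if "r \<le> norm x" for x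
    proof -
      have "(c / \<epsilon>) powr (1 / \<beta>) \<le> norm (x - x0)"
        using that norm_triangle_ineq2[of x x0] by (simp add: r_def)
      then have "((c / \<epsilon>) powr (1 / \<beta>)) powr \<beta> \<le> norm (x - x0) powr \<beta>"
        using \<beta> by (intro powr_mono2) auto
      then have le: "c / \<epsilon> \<le> norm (x - x0) powr \<beta>"
        using c \<epsilon> \<beta> by (simp add: powr_powr)
      moreover have "c / \<epsilon> > 0" using c \<epsilon> by simp
      ultimately have "norm (x - x0) powr \<beta> > 0" by linarith
      then have "\<Phi> x \<le> \<epsilon>"
        using le \<epsilon> by (simp add: \<Phi>_def powr_minus field_simps)
      then have "v x \<le> 0" using nn[of x] by (simp add: v_def)
      then show ?thesis by (simp add: w_def)
    qed
    have w_nonneg: "w x \<ge> 0" for x by (simp add: w_def)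
    have suppD: "D x = 0" if "r + 1 \<le> norm x" for x
      using grad_eq_0_outside[of r w x] supp that by (simp add: gradw)
    \<comment> \<open>The integrand of the difference of the two tested equations. Outside the ball
      D is a nonnegative multiple of the difference of the gradients, so monotonicity gives J >=
      0.\<close>
    define J where "J x = (pfield p (d\<Phi> x) - pfield p (grad u x)) \<bullet> D x" for x
    have J_nonneg: "J x \<ge> 0" for x
      using pfield_monotone(1)[OF p(1), of "d\<Phi> x" "grad u x"] by (simp add: J_def D_def)
    have cont1: "continuous_on UNIV (\<lambda>x. pfield p (d\<Phi> x) \<bullet> D x)"
    proof (rule continuous_on_extend_by_0[of x0 _ s])
      show "continuous_on (- {x0}) (\<lambda>x. pfield p (d\<Phi> x) \<bullet> D x)"
        by (intro continuous_intros continuous_on_compose2[OF continuous_pfield[OF p(1)] contv(2)]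
            continuous_on_subset[OF contD]) auto
    qed (use s in \<open>auto simp: D_def\<close>)
    have cont2: "continuous_on UNIV (\<lambda>x. pfield p (grad u x) \<bullet> D x)"
      by (intro continuous_intros continuous_on_compose2[OF continuous_pfield[OF p(1)] contu(2)] contD) auto
    have int1: "integrable lebesgue (\<lambda>x. pfield p (d\<Phi> x) \<bullet> D x)"
      by (rule integrable_lebesgue_compact_support[OF cont1, of "r + 1"]) (simp add: suppD)
    have int2: "integrable lebesgue (\<lambda>x. pfield p (grad u x) \<bullet> D x)"
      by (rule integrable_lebesgue_compact_support[OF cont2, of "r + 1"]) (simp add: suppD)
    have contJ: "continuous_on UNIV J"
      unfolding J_def[abs_def] inner_diff_left by (intro continuous_intros cont1 cont2)
    have intJ: "integrable lebesgue J"
      unfolding J_def[abs_def] inner_diff_left using int1 int2 by auto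
    have "(\<integral>x. pfield p (d\<Phi> x) \<bullet> D x \<partial>lebesgue)
        = (\<integral>x. - K * ((norm (x - x0) powr (- N) *\<^sub>R (x - x0)) \<bullet> D x) \<partial>lebesgue)"
    proof (rule Bochner_Integration.integral_cong[OF refl])
      show "pfield p (d\<Phi> x) \<bullet> D x = - K * ((norm (x - x0) powr (- N) *\<^sub>R (x - x0)) \<bullet> D x)" for x
        using pd\<Phi>[of x] s by (cases "x = x0") (auto simp: D_def)
    qed
    also have "\<dots> = - K * (\<integral>x. (norm (x - x0) powr (- N) *\<^sub>R (x - x0)) \<bullet> D x \<partial>lebesgue)"
      by (rule integral_mult_right_zero)
    also have "(\<integral>x. (norm (x - x0) powr (- N) *\<^sub>R (x - x0)) \<bullet> D x \<partial>lebesgue) = 0"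
      using integral_radial_field_grad_eq_0[of w r s x0, OF C1w supp s] by (simp add: gradw N_def w_def)
    \<comment> \<open>The flux of \<Phi> contributes 0 and u, being a supersolution, the sign <= 0,
      so the nonnegative J has integral 0.\<close>
    finally have "(\<integral>x. J x \<partial>lebesgue) = - (\<integral>x. pfield p (grad u x) \<bullet> D x \<partial>lebesgue)"
      unfolding J_def inner_diff_left using int1 int2 by simp
    also have "\<dots> \<le> 0"
      using super[of w r] C1w supp w_nonneg unfolding gradw by simp
    finally have "(\<integral>x. J x \<partial>lebesgue) = 0"
      by (intro antisym integral_nonneg_AE) (auto simp: J_nonneg)
    then have "AE x in lebesgue. J x = 0"
      using integral_nonneg_eq_0_iff_AE[OF intJ] J_nonneg by simp
    \<comment> \<open>A closed set of full measure is everything, so J vanishes at every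
      point.\<close>
    moreover have "closed {x. J x = 0}" by (intro closed_Collect_eq contJ continuous_intros)
    ultimately have J0: "J x = 0" for x using mem_closed_if_AE_lebesgue[of "{x. J x = 0}"] by simp
    \<comment> \<open>Where the truncation is active, J = 0 and strict monotonicity force the two
      gradients to agree; elsewhere D is 0 by definition.\<close>
    have "D x = 0" for x
    proof (cases "x \<in> ball x0 s \<or> v x \<le> 0")
      case False
      then have "(pfield p (d\<Phi> x) - pfield p (grad u x)) \<bullet> (d\<Phi> x - grad u x) = 0"
        using J0[of x] by (simp add: J_def D_def)
      then have "d\<Phi> x = grad u x" by (rule pfield_monotone(2)[OF p(1)])
      then show ?thesis by (simp add: D_def)
    qed (auto simp: D_def)
    then have "(w has_derivative (\<lambda>h. 0)) (at x)" for x using w[of x] by (simp add: gderiv_def)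
    then have "\<exists>k. \<forall>x\<in>UNIV. w x = k"
      by (intro has_derivative_zero_constant) auto
    then obtain k where k: "\<And>x. w x = k" by blast
    \<comment> \<open>The constant value of w is read off at a point beyond the support
      radius.\<close>
    obtain y :: 'a where "norm y = \<bar>r\<bar>" using vector_choose_size abs_ge_zero by blast
    then have "k = 0" using supp[of y] k by simp
    then show ?thesis using k[of x] \<open>x \<notin> ball x0 s\<close> by (simp add: w_def v_def)
  qed
  note approx = this
  have "\<Phi> x \<le> u x" if "x \<notin> ball x0 s" for x
  proof (rule field_le_epsilon)
    show "\<Phi> x \<le> u x + \<epsilon>" if "\<epsilon> > 0" for \<epsilon>
      using approx[OF that \<open>x \<notin> ball x0 s\<close>] by simp
  qed
  then show ?thesis
    unfolding \<Phi>_def \<beta>_def by (intro exI[of _ c] conjI allI impI c)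
qed

section \<open>Regularity of u and its decay at infinity\<close>

lemma C1_Hoelder_loc_imp_C_k_1:
  assumes "\<alpha> > 0" and u: "C1_Hoelder_loc \<alpha> u"
  shows "C_k 1 u"
  unfolding C_k_1_iff
proof
  show "\<forall>x. u differentiable (at x)" using u C1_Hoelder_loc_def by blast
  show "continuous_on UNIV (grad u)"
  proof -
    have "isCont (grad u) x" for x
    proof -
      have "\<exists>C. \<forall>y\<in>cball x 1. \<forall>z\<in>cball x 1. norm (grad u y - grad u z) \<le> C * dist y z powr \<alpha>"
        using u unfolding C1_Hoelder_loc_def by (meson compact_cball)
      then obtain C where C: "\<And>y z. y \<in> cball x 1 \<Longrightarrow> z \<in> cball x 1 \<Longrightarrow> norm (grad u y - grad u z) \<le> C * dist y z powr \<alpha>"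
        by blast
      have "((\<lambda>y. C * dist y x powr \<alpha>) \<longlongrightarrow> C * dist x x powr \<alpha>) (at x)"
        using \<open>\<alpha> > 0\<close> by (intro tendsto_intros tendsto_powr') auto
      then have "((\<lambda>y. C * dist y x powr \<alpha>) \<longlongrightarrow> 0) (at x)" by simp
      moreover have "eventually (\<lambda>y. norm (grad u y - grad u x) \<le> C * dist y x powr \<alpha>) (at x)"
        unfolding eventually_at
      proof (intro exI[of _ 1] conjI ballI impI)
        show "norm (grad u y - grad u x) \<le> C * dist y x powr \<alpha>" if "y \<noteq> x \<and> dist y x < 1" for y
          using that by (intro C) (simp_all add: dist_commute)
      qed simp
      ultimately have "((\<lambda>y. grad u y - grad u x) \<longlongrightarrow> 0) (at x)"
        by (rule Lim_null_comparison[rotated])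
      then show ?thesis by (simp add: isCont_def LIM_zero_iff)
    qed
    then show ?thesis by (simp add: continuous_at_imp_continuous_on)
  qed
qed

theorem proposition1p3:
  fixes p \<alpha> :: real
    and g u :: "real ^ 'n \<Rightarrow> real"
    and f :: "real \<Rightarrow> real"
  assumes "1 < p" and "p < real CARD('n)"
    and "continuous_on UNIV g" and "\<forall>x. g x > 0"
    and "continuous_on {0..} f" and "f 0 = 0" and "\<forall>t>0. f t > 0"
    and "u \<in> D1p p"
    and "\<alpha> > 0" and "C1_Hoelder_loc \<alpha> u"
    and "\<forall>x. u x \<ge> 0"
    and "p_Laplace_weak_solution p (\<lambda>x. g x * f (u x)) u"
    and "Liminf at_infinity
           (\<lambda>x. ereal (norm x powr ((real CARD('n) - p) / (p - 1)) * u x)) = 0"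
  shows "\<forall>x. u x = 0"
proof (rule ccontr)
  assume "\<not> (\<forall>x. u x = 0)"
  then obtain x0 where "u x0 \<noteq> 0" by blast
  then have x0: "u x0 > 0" using assms(11) by (metis less_eq_real_def)
  define \<beta> where "\<beta> = (real CARD('n) - p) / (p - 1)"
  have \<beta>: "\<beta> > 0" using assms(1,2) by (simp add: \<beta>_def)
  have u: "C_k 1 u" by (rule C1_Hoelder_loc_imp_C_k_1[OF assms(9,10)])
  \<comment> \<open>The nonnegative right-hand side makes u a supersolution; at zeros of u its value
    is 0 because \<open>f 0 = 0\<close>.\<close>
  have h: "g x * f (u x) \<ge> 0" for x
  proof -
    have "f (u x) \<ge> 0" using assms(6,7,11) by (metis less_eq_real_def)
    then show ?thesis using assms(4) by (simp add: less_imp_le)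
  qed
  have "isCont u x0"
    using C_k_imp_continuous[OF u] by (simp add: continuous_on_eq_continuous_at)
  then obtain d where d: "d > 0" "\<And>x. dist x x0 < d \<Longrightarrow> dist (u x) (u x0) < u x0 / 2"
    using x0 unfolding continuous_at_eps_delta by (metis half_gt_zero)
  \<comment> \<open>Halved because the comparison needs the lower bound u(x0)/2 on the ball of
    radius 2 s, which is the continuity ball of radius d.\<close>
  define s where "s = d / 2"
  have s: "s > 0" using d by (simp add: s_def)
  have um: "u x0 / 2 \<le> u x" if "x \<in> ball x0 (2 * s)" for x
    using d(2)[of x] that by (auto simp: s_def dist_commute dist_real_def abs_if split: if_splits)
  have "\<exists>c>0. \<forall>x. x \<notin> ball x0 s \<longrightarrow> c * norm (x - x0) powr (- ((real DIM(real ^ 'n) - p) / (p - 1))) \<le> u x"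
  proof (rule supersolution_ge_fundamental_solution[OF assms(1) _ u _ _ s _ um])
    show "p < real DIM(real ^ 'n)" using assms(2) by simp
    show "u x \<ge> 0" for x using assms(11) by blast
    show "u x0 / 2 > 0" using x0 by simp
    show "(\<integral>x. pfield p (grad u x) \<bullet> grad w x \<partial>lebesgue) \<ge> 0"
      if "C_k 1 w" "\<And>x. r \<le> norm x \<Longrightarrow> w x = 0" "\<And>x. w x \<ge> 0" for w r
      by (rule p_Laplace_supersolution_C1[OF assms(1) assms(12) h u that])
  qed
  then obtain c where c: "c > 0"
      "\<And>x. x \<notin> ball x0 s \<Longrightarrow> c * norm (x - x0) powr (- \<beta>) \<le> u x"
    unfolding \<beta>_def by auto
  \<comment> \<open>For |x| >= |x0| + s the point x lies outside the ball and |x - x0| <= 2 |x|.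
    Recentring the bound at the origin therefore costs the factor \<open>2 powr (- \<beta>)\<close>,
    and the product with |x|^\<beta> stays above a positive constant.\<close>
  have "eventually (\<lambda>x. ereal (c * 2 powr (- \<beta>)) \<le> ereal (norm x powr \<beta> * u x)) at_infinity"
    unfolding eventually_at_infinity
  proof (intro exI[of _ "norm x0 + s"] allI impI)
    fix x :: "real ^ 'n" assume x: "norm x0 + s \<le> norm x"
    have far: "s \<le> norm (x - x0)" using x norm_triangle_ineq2[of x x0] by linarith
    have "norm (x - x0) \<le> 2 * norm x" using x s norm_triangle_ineq4[of x x0] by linarith
    then have "(2 * norm x) powr (- \<beta>) \<le> norm (x - x0) powr (- \<beta>)"
      using far s \<beta> by (intro powr_mono2') auto
    then have "c * (2 * norm x) powr (- \<beta>) \<le> c * norm (x - x0) powr (- \<beta>)"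
      using c(1) by simp
    also have "\<dots> \<le> u x" using far by (intro c(2)) (simp add: dist_norm norm_minus_commute)
    finally have "norm x powr \<beta> * (c * (2 * norm x) powr (- \<beta>)) \<le> norm x powr \<beta> * u x"
      by (intro mult_left_mono) auto
    moreover have "norm x > 0" using x s norm_ge_zero[of x0] by linarith
    then have "norm x powr \<beta> * (c * (2 * norm x) powr (- \<beta>)) = c * 2 powr (- \<beta>)"
      by (simp add: powr_mult powr_minus field_simps)
    ultimately show "ereal (c * 2 powr (- \<beta>)) \<le> ereal (norm x powr \<beta> * u x)" by simp
  qed
  then have "ereal (c * 2 powr (- \<beta>)) \<le> Liminf at_infinity (\<lambda>x. ereal (norm x powr \<beta> * u x))"
    by (rule Liminf_bounded)
  then have "c * 2 powr (- \<beta>) \<le> 0"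
    using assms(13) by (simp add: \<beta>_def zero_ereal_def)
  moreover have "c * 2 powr (- \<beta>) > 0" using c(1) by simp
  ultimately show False by linarith
qed

end
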